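(* Let $\mathfrak A\subset\mathcal A^{\mathbb Z^D}$ be a subshift and let $(\mathcal G,+)$ be an abelian group. There are canonical isomorphisms $\mathcal Z^1_{\mathrm{eq}}(\mathfrak A,\mathcal G)\cong\mathcal Z^1_{\mathrm{dy}}(\mathfrak A,\mathcal G)$ and $\mathcal H^1_{\mathrm{eq}}(\mathfrak A,\mathcal G)\cong\mathcal H^1_{\mathrm{dy}}(\mathfrak A,\mathcal G)$.
   Context: $\mathcal A$ is a finite alphabet, $D\ge1$; $\mathcal A^{\mathbb Z^D}$ carries the product topology; $\sigma^{\mathsf v}(\mathbf a)_{\mathsf z}=a_{\mathsf z+\mathsf v}$; a subshift is a closed shift-invariant subset. $\mathcal G$ is an abelian topological group. **Equivariant cohomology.** $\mathbf Y$ is the canonical cell decomposition of $\mathbb R^D$ with vertex set $\mathbb Z^D$ and top cells the unit cubes $\mathsf z+[0,1]^D$; $\mathbf Y^d$ is its set of (oriented) $d$-cells, $\mathbb Z[\mathbf Y^d]$ the free abelian group of $d$-chains, $\partial_d:\mathbb Z[\mathbf Y^d]\to\mathbb Z[\mathbf Y^{d-1}]$ the cubical boundary. $\dot{\mathsf z}$ denotes the vertex $\mathsf z$ as a 0-cell and, for adjacent $\mathsf x,\mathsf y$, $(\mathsf x\to\mathsf y)$ is the oriented edge, with $\partial_1(\mathsf x\to\mathsf y)=\dot{\mathsf y}-\dot{\mathsf x}$. $\Upsilon^{\mathsf z}_d:\mathbb Z[\mathbf Y^d]\to\mathbb Z[\mathbf Y^d]$ is translation by $\mathsf z\in\mathbb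 Z^D$. A ($d$-dimensional, $\mathcal G$-valued, continuous) equivariant cochain is a continuous function $C:\mathbb Z[\mathbf Y^d]\times\mathfrak A\to\mathcal G$, additive in the first variable, such that $C(\zeta,\sigma^{\mathsf z}(\mathbf a))=C(\Upsilon_d^{\mathsf z}(\zeta),\mathbf a)$ for all $\zeta\in\mathbb Z[\mathbf Y^d]$, $\mathbf a\in\mathfrak A$, $\mathsf z\in\mathbb Z^D$. They form a group $\mathcal C^d_{\mathrm{eq}}(\mathfrak A,\mathcal G)$; $\delta_dC(\zeta,\mathbf a):=C(\partial_{d+1}\zeta,\mathbf a)$. $\mathcal Z^d_{\mathrm{eq}}=\ker\delta_d$, $\mathcal B^d_{\mathrm{eq}}=\mathrm{image}(\delta_{d-1})$, $\mathcal H^d_{\mathrm{eq}}=\mathcal Z^d_{\mathrm{eq}}/\mathcal B^d_{\mathrm{eq}}$. **Dynamical cohomology.** $\mathcal Z^1_{\mathrm{dy}}(\mathfrak A,\mathcal G)$ is the group of dynamical cocycles, i.e. continuous $\widetilde C:\mathbb Z^D\times\mathfrak A\to\mathcal G$ with $\widetilde C(\mathsf y+\mathsf z,\mathbf a)=\widetilde C(\mathsf y,\sigma^{\mathsf z}(\mathbf a))+\widetilde C(\mathsf z,\mathbf a)$. $\widetilde C_1,\widetilde C_2$ are cohomologous if there is a continuous $\widetilde B:\mathfrak A\to\mathcal G$ with $\widetilde C_2(\mathsf z,\mathbf a)=\widetilde B(\sigma^{\mathsf z}(\mathbf a))+\widetilde C_1(\mathsf z,\mathbf a)-\widetilde B(\mathbf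 a)$. A dynamical cocycle is trivial if it is cohomologous to one of the form $(\mathsf z,\mathbf a)\mapsto h(\mathsf z)$ with $h:\mathbb Z^D\to\mathcal G$ a homomorphism; the trivial cocycles form a subgroup $\mathcal B^1_{\mathrm{dy}}(\mathfrak A,\mathcal G)$, and $\mathcal H^1_{\mathrm{dy}}(\mathfrak A,\mathcal G):=\mathcal Z^1_{\mathrm{dy}}(\mathfrak A,\mathcal G)/\mathcal B^1_{\mathrm{dy}}(\mathfrak A,\mathcal G)$ is the dynamical cohomology group. The isomorphisms come from the correspondence $C\leftrightarrow\widetilde C$ given by $\widetilde C(\mathsf z,\mathbf a)=C(\zeta,\mathbf a)$ for any 1-chain $\zeta$ with $\partial_1\zeta=\dot{\mathsf z}-\dot{\mathsf 0}$, and $C((\mathsf x\to\mathsf y),\mathbf a)=\widetilde C(\mathsf y-\mathsf x,\sigma^{\mathsf x}(\mathbf a))$.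
   Formalization: The second isomorphism is proved with trivial cocycles meaning those cohomologous to 0; with cocycles cohomologous to any homomorphism it fails (one constant configuration), and there H^1_eq modulo the classes of configuration-independent cocycles is shown isomorphic to H^1_dy. *)

theory Defs
  imports "HOL-Analysis.Analysis" "HOL-Algebra.Coset" "HOL-Algebra.Free_Abelian_Groups"
begin

text \<open>
  The lattice is \<open>int ^ 'd\<close>, with \<open>CARD('d)\<close> its rank; the linear order on the index
  type \<open>'d\<close> only fixes the orientations of the cubical cells.  The alphabet is the finite
  type \<open>'a\<close>, and coefficients lie in a type \<open>'g\<close> that is an abelian topological group.
\<close>

type_synonym ('a, 'd) config = "(int ^ 'd) \<Rightarrow> 'a"

definition config_space :: "('a, 'd) config topology" where
  "config_space = product_topology (\<lambda>_. discrete_topology UNIV) UNIV"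

definition shift :: "int ^ 'd::finite \<Rightarrow> ('a, 'd) config \<Rightarrow> ('a, 'd) config" where
  "shift v a = (\<lambda>z. a (z + v))"

definition subshift :: "('a::finite, 'd::finite) config set \<Rightarrow> bool" where
  "subshift \<AA> \<longleftrightarrow> closedin config_space \<AA> \<and> (\<forall>v. shift v ` \<AA> = \<AA>)"


section \<open>Cubical chains\<close>

text \<open>
  The pair \<open>(x, S)\<close> is the cell \<open>x + {t. (\<forall>i \<in> S. 0 \<le> t$i \<le> 1) \<and> (\<forall>i. i \<notin> S \<longrightarrow> t$i = 0)}\<close>,
  oriented by the increasing order on \<open>S\<close>; the same cell with the opposite orientation is
  the negative of this generator.  In particular \<open>(x, {})\<close> is the vertex \<open>x\<close>, and
  \<open>(x, {i})\<close> is the edge from \<open>x\<close> to \<open>x + axis i 1\<close>.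
\<close>

type_synonym 'd cell = "(int ^ 'd) \<times> 'd set"

definition cells :: "nat \<Rightarrow> 'd::finite cell set" where
  "cells d = {(x, S). card S = d}"

abbreviation chains :: "nat \<Rightarrow> ('d::finite cell \<Rightarrow>\<^sub>0 int) set" where
  "chains d \<equiv> carrier (free_Abelian_group (cells d))"

definition cell_boundary :: "'d::{finite,linorder} cell \<Rightarrow> ('d cell \<Rightarrow>\<^sub>0 int)" where
  "cell_boundary = (\<lambda>(x, S).
     \<Sum>i\<in>S. frag_cmul ((-1) ^ card {j \<in> S. j < i})
               (frag_of (x + axis i 1, S - {i}) - frag_of (x, S - {i})))"

definition boundary :: "('d::{finite,linorder} cell \<Rightarrow>\<^sub>0 int) \<Rightarrow> ('d cell \<Rightarrow>\<^sub>0 int)" where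
  "boundary = frag_extend cell_boundary"

definition translate :: "int ^ 'd::finite \<Rightarrow> ('d cell \<Rightarrow>\<^sub>0 int) \<Rightarrow> ('d cell \<Rightarrow>\<^sub>0 int)" where
  "translate z = frag_extend (\<lambda>(x, S). frag_of (x + z, S))"

definition vertex :: "int ^ 'd::finite \<Rightarrow> ('d cell \<Rightarrow>\<^sub>0 int)" where
  "vertex z = frag_of (z, {})"

definition adjacent :: "int ^ 'd::finite \<Rightarrow> int ^ 'd \<Rightarrow> bool" where
  "adjacent x y \<longleftrightarrow> (\<exists>i. y = x + axis i 1 \<or> x = y + axis i 1)"

text \<open>Only meaningful for adjacent \<open>x\<close> and \<open>y\<close>.\<close>

definition edge :: "int ^ 'd::finite \<Rightarrow> int ^ 'd \<Rightarrow> ('d cell \<Rightarrow>\<^sub>0 int)" where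
  "edge x y = (if \<exists>i. y = x + axis i 1
               then frag_of (x, {THE i. y = x + axis i 1})
               else - frag_of (y, {THE i. x = y + axis i 1}))"


section \<open>Equivariant cohomology\<close>

type_synonym ('a, 'd, 'g) chain_fun = "('d cell \<Rightarrow>\<^sub>0 int) \<Rightarrow> ('a, 'd) config \<Rightarrow> 'g"
type_synonym ('a, 'd, 'g) lattice_fun = "(int ^ 'd) \<Rightarrow> ('a, 'd) config \<Rightarrow> 'g"

text \<open>
  A function with domain \<open>chains d \<times> \<AA>\<close> or \<open>UNIV \<times> \<AA>\<close> is represented by its extension
  by \<open>0\<close>, so that equality of such functions is equality of the represented functions.
\<close>

definition equivariant_cochain ::
  "nat \<Rightarrow> ('a::finite, 'd::{finite,linorder}) config set
     \<Rightarrow> ('a, 'd, 'g::topological_ab_group_add) chain_fun \<Rightarrow> bool" where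
  "equivariant_cochain d \<AA> C \<longleftrightarrow>
     (\<forall>\<zeta> a. \<not> (\<zeta> \<in> chains d \<and> a \<in> \<AA>) \<longrightarrow> C \<zeta> a = 0) \<and>
     continuous_map
       (prod_topology (discrete_topology (chains d)) (subtopology config_space \<AA>)) euclidean
       (\<lambda>(\<zeta>, a). C \<zeta> a) \<and>
     (\<forall>\<zeta>\<in>chains d. \<forall>\<xi>\<in>chains d. \<forall>a\<in>\<AA>. C (\<zeta> + \<xi>) a = C \<zeta> a + C \<xi> a) \<and>
     (\<forall>\<zeta>\<in>chains d. \<forall>a\<in>\<AA>. \<forall>z. C \<zeta> (shift z a) = C (translate z \<zeta>) a)"

definition C_eq ::
  "nat \<Rightarrow> ('a::finite, 'd::{finite,linorder}) config set
     \<Rightarrow> ('a, 'd, 'g::topological_ab_group_add) chain_fun monoid" where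
  "C_eq d \<AA> = \<lparr>carrier = {C. equivariant_cochain d \<AA> C},
               monoid.mult = (\<lambda>C C'. \<lambda>\<zeta> a. C \<zeta> a + C' \<zeta> a),
               monoid.one = (\<lambda>_ _. 0)\<rparr>"

definition coboundary ::
  "nat \<Rightarrow> ('a::finite, 'd::{finite,linorder}) config set
     \<Rightarrow> ('a, 'd, 'g::topological_ab_group_add) chain_fun
     \<Rightarrow> ('a, 'd, 'g) chain_fun" where
  "coboundary d \<AA> C = (\<lambda>\<zeta> a. if \<zeta> \<in> chains (Suc d) \<and> a \<in> \<AA> then C (boundary \<zeta>) a else 0)"

definition Z_eq ::
  "nat \<Rightarrow> ('a::finite, 'd::{finite,linorder}) config set
     \<Rightarrow> ('a, 'd, 'g::topological_ab_group_add) chain_fun monoid" where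
  "Z_eq d \<AA> = (C_eq d \<AA>)\<lparr>carrier := kernel (C_eq d \<AA>) (C_eq (Suc d) \<AA>) (coboundary d \<AA>)\<rparr>"

fun B_eq ::
  "nat \<Rightarrow> ('a::finite, 'd::{finite,linorder}) config set
     \<Rightarrow> ('a, 'd, 'g::topological_ab_group_add) chain_fun set" where
  "B_eq 0 \<AA> = {\<lambda>_ _. 0}"
| "B_eq (Suc d) \<AA> = coboundary d \<AA> ` carrier (C_eq d \<AA>)"

definition H_eq ::
  "nat \<Rightarrow> ('a::finite, 'd::{finite,linorder}) config set
     \<Rightarrow> ('a, 'd, 'g::topological_ab_group_add) chain_fun set monoid" where
  "H_eq d \<AA> = Z_eq d \<AA> Mod B_eq d \<AA>"


section \<open>Dynamical cohomology\<close>

definition dynamical_cocycle ::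
  "('a::finite, 'd::finite) config set
     \<Rightarrow> ('a, 'd, 'g::topological_ab_group_add) lattice_fun \<Rightarrow> bool" where
  "dynamical_cocycle \<AA> C \<longleftrightarrow>
     (\<forall>z a. a \<notin> \<AA> \<longrightarrow> C z a = 0) \<and>
     continuous_map
       (prod_topology (discrete_topology UNIV) (subtopology config_space \<AA>)) euclidean
       (\<lambda>(z, a). C z a) \<and>
     (\<forall>y z. \<forall>a\<in>\<AA>. C (y + z) a = C y (shift z a) + C z a)"

definition cohomologous ::
  "('a::finite, 'd::finite) config set
     \<Rightarrow> ('a, 'd, 'g::topological_ab_group_add) lattice_fun
     \<Rightarrow> ('a, 'd, 'g) lattice_fun \<Rightarrow> bool" where
  "cohomologous \<AA> C1 C2 \<longleftrightarrow>
     (\<exists>B. continuous_map (subtopology config_space \<AA>) euclidean B \<and>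
          (\<forall>z. \<forall>a\<in>\<AA>. C2 z a = B (shift z a) + C1 z a - B a))"

definition Z_dy ::
  "('a::finite, 'd::finite) config set
     \<Rightarrow> ('a, 'd, 'g::topological_ab_group_add) lattice_fun monoid" where
  "Z_dy \<AA> = \<lparr>carrier = {C. dynamical_cocycle \<AA> C},
             monoid.mult = (\<lambda>C C'. \<lambda>z a. C z a + C' z a),
             monoid.one = (\<lambda>_ _. 0)\<rparr>"

text \<open>
  Two subgroups of \<open>Z_dy \<AA>\<close> have to be distinguished: the cocycles cohomologous to \<open>0\<close>, and
  the larger group of cocycles cohomologous to a homomorphism.  The coboundaries in \<open>B_eq 1 \<AA>\<close>
  correspond to the former: a 0-cochain \<open>C\<close> is determined by \<open>b a = C (vertex 0) a\<close>, and its
  coboundary corresponds to the cocycle \<open>b (shift z a) - b a\<close>.  Hence \<open>H_eq 1 \<AA>\<close> is the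
  group of cohomology classes \<open>H_dy \<AA>\<close>, and is in general not isomorphic to \<open>H_dy_triv \<AA>\<close>: if
  \<open>\<AA>\<close> consists of one constant configuration, then \<open>H_eq 1 \<AA>\<close> is \<open>'g ^ 'd\<close>, whereas every
  dynamical cocycle on \<open>\<AA>\<close> is a homomorphism and \<open>H_dy_triv \<AA>\<close> is the trivial group.
\<close>

definition B_dy ::
  "('a::finite, 'd::finite) config set
     \<Rightarrow> ('a, 'd, 'g::topological_ab_group_add) lattice_fun set" where
  "B_dy \<AA> = {C \<in> carrier (Z_dy \<AA>). cohomologous \<AA> (\<lambda>_ _. 0) C}"

definition B_dy_triv ::
  "('a::finite, 'd::finite) config set
     \<Rightarrow> ('a, 'd, 'g::topological_ab_group_add) lattice_fun set" where
  "B_dy_triv \<AA> = {C \<in> carrier (Z_dy \<AA>).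
     \<exists>h. (\<forall>y z. h (y + z) = h y + h z) \<and> cohomologous \<AA> (\<lambda>z _. h z) C}"

definition H_dy ::
  "('a::finite, 'd::finite) config set
     \<Rightarrow> ('a, 'd, 'g::topological_ab_group_add) lattice_fun set monoid" where
  "H_dy \<AA> = Z_dy \<AA> Mod B_dy \<AA>"

definition H_dy_triv ::
  "('a::finite, 'd::finite) config set
     \<Rightarrow> ('a, 'd, 'g::topological_ab_group_add) lattice_fun set monoid" where
  "H_dy_triv \<AA> = Z_dy \<AA> Mod B_dy_triv \<AA>"

text \<open>
  The classes in \<open>H_eq d \<AA>\<close> of cocycles whose values do not depend on the configuration; for
  \<open>d = 1\<close> these cocycles correspond to the homomorphisms from the lattice to \<open>'g\<close>.
\<close>

definition const_classes ::
  "nat \<Rightarrow> ('a::finite, 'd::{finite,linorder}) config set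
     \<Rightarrow> ('a, 'd, 'g::topological_ab_group_add) chain_fun set set" where
  "const_classes d \<AA> =
     (\<lambda>C. B_eq d \<AA> #>\<^bsub>Z_eq d \<AA>\<^esub> C) `
       {C \<in> carrier (Z_eq d \<AA>). \<forall>\<zeta>. \<forall>a\<in>\<AA>. \<forall>b\<in>\<AA>. C \<zeta> a = C \<zeta> b}"

end

theory Submission
  imports Defs
begin

text \<open>
  The value of a closed equivariant 1-cochain on a chain depends only on the boundary of the
  chain: on the simply connected lattice, for a fixed configuration, it is the difference of a
  potential.  Evaluating along any path from \<open>0\<close> to \<open>z\<close> therefore defines \<open>\<Phi>\<close>; additivity and
  equivariance turn concatenation of paths into the cocycle identity.  A dynamical cocycle \<open>D\<close> is
  recovered from the cochain whose value on the edge from \<open>x\<close> to \<open>y\<close> is \<open>D (y - x) (shift x a)\<close>.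
  Under \<open>\<Phi>\<close>, the coboundary of a 0-cochain \<open>C\<close> becomes the coboundary of \<open>a \<mapsto> C (vertex 0) a\<close>,
  and the cocycles cohomologous to a homomorphism correspond to coboundaries plus cochains
  independent of the configuration; this gives both quotient isomorphisms.
\<close>

section \<open>Topological preliminaries\<close>

lemma continuous_map_topological_diff:
  fixes f g :: "'x \<Rightarrow> 'g::topological_ab_group_add"
  assumes "continuous_map X euclidean f" "continuous_map X euclidean g"
  shows "continuous_map X euclidean (\<lambda>x. f x - g x)"
  using assms by (simp add: continuous_map_atin tendsto_diff)

text \<open>The slices over a discrete factor are open and cover the product, so joint continuity
  splits into continuity on each slice. This reduces the continuity of cochains and cocycles to one
  chain or one lattice vector at a time.\<close>

lemma continuous_map_prod_discrete_iff:
  "continuous_map (prod_topology (discrete_topology S) X) Y (\<lambda>(s, x). f s x) \<longleftrightarrow>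
     (\<forall>s\<in>S. continuous_map X Y (f s))"
proof
  assume cont: "continuous_map (prod_topology (discrete_topology S) X) Y (\<lambda>(s, x). f s x)"
  show "\<forall>s\<in>S. continuous_map X Y (f s)"
  proof
    fix s assume "s \<in> S"
    then have "continuous_map X (prod_topology (discrete_topology S) X) (\<lambda>x. (s, x))"
      by (intro continuous_map_pairedI) auto
    from continuous_map_compose[OF this cont] show "continuous_map X Y (f s)"
      by (simp add: o_def)
  qed
next
  assume cont: "\<forall>s\<in>S. continuous_map X Y (f s)"
  show "continuous_map (prod_topology (discrete_topology S) X) Y (\<lambda>(s, x). f s x)"
    unfolding continuous_map_def
  proof (intro conjI allI impI)
    show "(\<lambda>(s, x). f s x) \<in> topspace (prod_topology (discrete_topology S) X) \<rightarrow> topspace Y"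
      using cont by (auto simp: continuous_map_def)
    fix U assume "openin Y U"
    have "{p \<in> topspace (prod_topology (discrete_topology S) X). (\<lambda>(s, x). f s x) p \<in> U}
        = (\<Union>s\<in>S. {s} \<times> {x \<in> topspace X. f s x \<in> U})"
      by auto
    moreover have "openin (prod_topology (discrete_topology S) X) ({s} \<times> {x \<in> topspace X. f s x \<in> U})"
      if "s \<in> S" for s
      using that cont \<open>openin Y U\<close> by (auto simp: openin_prod_Times_iff continuous_map_def)
    ultimately show "openin (prod_topology (discrete_topology S) X)
        {p \<in> topspace (prod_topology (discrete_topology S) X). (\<lambda>(s, x). f s x) p \<in> U}"
      by (auto intro: openin_Union)
  qed
qed

lemma shift_0 [simp]: "shift 0 a = a"
  by (simp add: shift_def)

lemma shift_shift [simp]: "shift x (shift z a) = shift (x + z) a"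
  by (simp add: shift_def algebra_simps)

lemma shift_mem: "subshift \<AA> \<Longrightarrow> a \<in> \<AA> \<Longrightarrow> shift v a \<in> \<AA>"
  unfolding subshift_def by blast

text \<open>Each coordinate of \<open>shift v a\<close> is a coordinate of \<open>a\<close>, so
  continuity is checked componentwise; invariance of \<open>\<AA>\<close> keeps the image
  inside.\<close>

lemma continuous_map_shift:
  assumes "subshift \<AA>"
  shows "continuous_map (subtopology config_space \<AA>) (subtopology config_space \<AA>) (shift v)"
proof -
  have "continuous_map config_space config_space (shift v)"
    unfolding config_space_def shift_def continuous_map_componentwise_UNIV
    by (auto intro: continuous_map_product_projection)
  then show ?thesis
    using shift_mem[OF assms]
    by (auto simp: continuous_map_in_subtopology intro: continuous_map_from_subtopology)
qed

lemma continuous_map_compose_shift: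
  assumes "subshift \<AA>" "continuous_map (subtopology config_space \<AA>) Y f"
  shows "continuous_map (subtopology config_space \<AA>) Y (\<lambda>a. f (shift v a))"
  using continuous_map_compose[OF continuous_map_shift[OF assms(1)] assms(2)] by (simp add: o_def)


section \<open>Potentials on the lattice\<close>

text \<open>Unit vectors and their negatives generate the lattice: integer induction moves along a
  single axis, and a sum over the axes reaches \<open>z\<close>.\<close>

lemma lattice_induct [case_names zero plus minus]:
  fixes z :: "int ^ 'd::finite"
  assumes zero: "P 0"
    and plus: "\<And>x i. P x \<Longrightarrow> P (x + axis i 1)"
    and minus: "\<And>x i. P x \<Longrightarrow> P (x - axis i 1)"
  shows "P z"
proof -
  have line: "P (x + axis i k)" if "P x" for x i and k :: int
  proof (induction k rule: int_induct[where k = 0])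
    case base
    then show ?case using that by (simp add: axis_def zero_vec_def[symmetric])
  next
    case (step1 k)
    have "x + axis i (k + 1) = x + axis i k + axis i 1"
      by (simp add: vec_eq_iff axis_def)
    then show ?case using plus[OF step1(2)] by (simp only:)
  next
    case (step2 k)
    have "x + axis i (k - 1) = x + axis i k - axis i 1"
      by (simp add: vec_eq_iff axis_def)
    then show ?case using minus[OF step2(2)] by (simp only:)
  qed
  have "P (\<Sum>i\<in>S. axis i (z $ i))" for S
  proof (induction S rule: infinite_finite_induct)
    case (insert i S)
    then show ?case using line[OF insert.IH] by (simp add: add.commute)
  qed (auto intro: zero)
  moreover have "(\<Sum>i\<in>UNIV. axis i (z $ i)) = z"
    by (simp add: vec_eq_iff axis_def if_distrib[of "\<lambda>f. f _"] cong: if_cong)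
  ultimately show ?thesis by metis
qed

text \<open>The discrete antiderivative on all integers that vanishes at 0. At least one of the two
  sums is empty; the minus sign keeps the recursion valid for negative \<open>t\<close>.\<close>

definition int_sum :: "(int \<Rightarrow> 'g::ab_group_add) \<Rightarrow> int \<Rightarrow> 'g" where
  "int_sum h t = (\<Sum>s\<in>{0..<t}. h s) - (\<Sum>s\<in>{t..<0}. h s)"

lemma int_sum_step: "int_sum h (t + 1) - int_sum h t = h t"
proof (cases "t \<ge> 0")
  case True
  then have "{0..<t + 1} = insert t {0..<t}" by auto
  with True show ?thesis by (simp add: int_sum_def)
next
  case False
  then have "{t..<0} = insert t {t + 1..<0}" by auto
  with False show ?thesis by (simp add: int_sum_def)
qed

text \<open>
  Directions are integrated one at a time: once the form vanishes in the directions \<open>S\<close>,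
  closedness makes its \<open>j\<close>-component invariant under translation in those directions, so that
  integrating it along the \<open>j\<close>-axis does not disturb them.
\<close>

lemma lattice_potential_on:
  fixes c :: "int ^ 'd::finite \<Rightarrow> 'd \<Rightarrow> 'g::ab_group_add"
  assumes "finite S"
    and closed: "\<And>x i j. c x i + c (x + axis i 1) j = c x j + c (x + axis j 1) i"
  shows "\<exists>f. \<forall>x. \<forall>i\<in>S. f (x + axis i 1) - f x = c x i"
  using \<open>finite S\<close>
proof (induction S)
  case empty
  then show ?case by simp
next
  case (insert j S)
  then obtain f where f: "\<And>x i. i \<in> S \<Longrightarrow> f (x + axis i 1) - f x = c x i" by blast
  \<comment> \<open>Subtracting the differences of \<open>f\<close> makes the components in
    \<open>S\<close> vanish; \<open>d\<close> is the \<open>j\<close>-component of what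
    remains.\<close>
  define d where "d x = c x j - (f (x + axis j 1) - f x)" for x
  have inv: "d (x + axis i 1) = d x" if "i \<in> S" for x i
  proof -
    have "f (x + axis j 1 + axis i 1) = c (x + axis j 1) i + f (x + axis j 1)"
      "f (x + axis i 1) = c x i + f x"
      using f[OF that, of x] f[OF that, of "x + axis j 1"] by (auto simp: algebra_simps)
    moreover have "c (x + axis j 1) i = c x i + c (x + axis i 1) j - c x j"
      using closed[of x i j] by (simp add: algebra_simps)
    ultimately show ?thesis
      by (simp add: d_def algebra_simps)
  qed
  \<comment> \<open>\<open>r\<close> projects to the hyperplane where the \<open>j\<close>-th
    coordinate is 0, and \<open>g\<close> sums \<open>d\<close> from there along the
    \<open>j\<close>-line to \<open>x\<close>.\<close>
  define r where "r x = x - axis j (x $ j)" for x :: "int ^ 'd"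
  define g where "g x = int_sum (\<lambda>t. d (r x + axis j t)) (x $ j)" for x
  have gj: "g (x + axis j 1) - g x = d x" for x
  proof -
    have "r (x + axis j 1) = r x" "(x + axis j 1) $ j = x $ j + 1" "r x + axis j (x $ j) = x"
      by (auto simp: r_def vec_eq_iff axis_def)
    then show ?thesis by (simp add: g_def int_sum_step)
  qed
  have gi: "g (x + axis i 1) = g x" if "i \<in> S" for x i
  proof -
    have "i \<noteq> j" using that insert.hyps by auto
    then have "r (x + axis i 1) + axis j t = r x + axis j t + axis i 1"
      and "(x + axis i 1) $ j = x $ j" for t
      by (auto simp: r_def vec_eq_iff axis_def)
    with inv[OF that] show ?thesis by (simp only: g_def)
  qed
  have "(f (x + axis i 1) + g (x + axis i 1)) - (f x + g x) = c x i" if "i \<in> insert j S" for x i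
  proof (cases "i = j")
    case True
    then show ?thesis using gj[of x] by (simp add: d_def algebra_simps)
  next
    case False
    then show ?thesis using that gi[of i x] f[of i x] by (simp add: algebra_simps)
  qed
  then show ?case by (intro exI[of _ "\<lambda>x. f x + g x"]) auto
qed

text \<open>The discrete Poincare lemma in degree one: all directions have been integrated.\<close>

lemma lattice_potential:
  fixes c :: "int ^ 'd::finite \<Rightarrow> 'd \<Rightarrow> 'g::ab_group_add"
  assumes "\<And>x i j. c x i + c (x + axis i 1) j = c x j + c (x + axis j 1) i"
  obtains f where "\<And>x i. f (x + axis i 1) - f x = c x i"
  using lattice_potential_on[OF finite_class.finite_UNIV, of c] assms by blast


section \<open>Chains\<close>

text \<open>The universal property of the free abelian group, applied to the coefficient type
  packaged as the record \<open>G\<close>. The conclusion speaks of differences because induction on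
  chains proceeds by subtraction.\<close>

lemma frag_lift_exists:
  fixes f :: "'c \<Rightarrow> 'g::ab_group_add"
  shows "\<exists>h. (\<forall>x. h (frag_of x) = f x) \<and> (\<forall>c d. h (c - d) = h c - h d)"
proof -
  define G :: "'g monoid" where "G = \<lparr>carrier = UNIV, monoid.mult = (+), monoid.one = 0\<rparr>"
  interpret G: comm_group G
  proof (rule comm_groupI)
    show "\<exists>y\<in>carrier G. y \<otimes>\<^bsub>G\<^esub> x = \<one>\<^bsub>G\<^esub>" for x
      by (auto simp: G_def intro: exI[of _ "- x"])
  qed (auto simp: G_def algebra_simps)
  obtain h where h: "h \<in> hom (free_Abelian_group UNIV) G" "\<And>x. h (frag_of x) = f x"
    by (rule G.free_Abelian_group_universal[of f UNIV]) (auto simp: G_def)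
  have add: "h (c + d) = h c + h d" for c d
    using h(1) by (auto simp: hom_def G_def)
  have "h (c - d) = h c - h d" for c d
    using add[of "c - d" d] by (simp add: algebra_simps)
  with h(2) show ?thesis by blast
qed

text \<open>The additive extension of \<open>f\<close>, with values in any abelian group. The choice
  is harmless: the values on generators and compatibility with differences determine the
  map.\<close>

definition frag_lift :: "('c \<Rightarrow> 'g::ab_group_add) \<Rightarrow> ('c \<Rightarrow>\<^sub>0 int) \<Rightarrow> 'g" where
  "frag_lift f = (SOME h. (\<forall>x. h (frag_of x) = f x) \<and> (\<forall>c d. h (c - d) = h c - h d))"

lemma frag_lift_of [simp]: "frag_lift f (frag_of x) = f x"
  and frag_lift_diff: "frag_lift f (c - d) = frag_lift f c - frag_lift f d"
  using someI_ex[OF frag_lift_exists[of f]] unfolding frag_lift_def by blast+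

lemma frag_lift_0 [simp]: "frag_lift f 0 = 0"
  using frag_lift_diff[of f 0 0] by simp

lemma frag_lift_add: "frag_lift f (c + d) = frag_lift f c + frag_lift f d"
  using frag_lift_diff[of f "c + d" d] by (simp add: algebra_simps)

lemma chains_0 [simp]: "0 \<in> chains d"
  by simp

lemma chains_diff: "\<zeta> \<in> chains d \<Longrightarrow> \<xi> \<in> chains d \<Longrightarrow> \<zeta> - \<xi> \<in> chains d"
  using keys_diff[of \<zeta> \<xi>] by auto

lemma chains_add: "\<zeta> \<in> chains d \<Longrightarrow> \<xi> \<in> chains d \<Longrightarrow> \<zeta> + \<xi> \<in> chains d"
  using keys_add[of \<zeta> \<xi>] by auto

lemma chains_frag_of: "frag_of (x, S) \<in> chains d \<longleftrightarrow> card S = d"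
  by (simp add: cells_def)

text \<open>Cells generate the chains under subtraction; membership is carried through the induction
  so that the dimension is known in the difference case.\<close>

lemma chains_induct [consumes 1, case_names zero cell diff]:
  assumes "\<zeta> \<in> chains d"
    and zero: "P 0"
    and cell: "\<And>x S. card S = d \<Longrightarrow> P (frag_of (x, S))"
    and diff: "\<And>\<zeta> \<xi>. \<zeta> \<in> chains d \<Longrightarrow> \<xi> \<in> chains d \<Longrightarrow> P \<zeta> \<Longrightarrow> P \<xi> \<Longrightarrow> P (\<zeta> - \<xi>)"
  shows "P \<zeta>"
proof -
  have "\<zeta> \<in> chains d \<and> P \<zeta>"
    using assms(1)[unfolded carrier_free_Abelian_group_iff]
  proof (induction \<zeta> rule: frag_induction)
    case (one c)
    then show ?case using cell by (cases c) (auto simp: cells_def)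
  next
    case (diff \<zeta> \<xi>)
    then show ?case using assms(4) chains_diff by blast
  qed (use zero in auto)
  then show ?thesis ..
qed

section \<open>Translation and boundary\<close>

lemma translate_diff: "translate z (\<zeta> - \<xi>) = translate z \<zeta> - translate z \<xi>"
  by (simp add: translate_def frag_extend_diff)

lemma translate_0 [simp]: "translate z 0 = 0"
  by (simp add: translate_def)

lemma translate_frag_of [simp]: "translate z (frag_of (x, S)) = frag_of (x + z, S)"
  by (simp add: translate_def)

lemma translate_vertex: "translate z (vertex x) = vertex (x + z)"
  by (simp add: vertex_def)

lemma translate_chains: "\<zeta> \<in> chains d \<Longrightarrow> translate z \<zeta> \<in> chains d"
  by (induction \<zeta> rule: chains_induct)
    (simp_all only: translate_diff chains_diff translate_0 chains_0 translate_frag_of chains_frag_of)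

lemma boundary_diff: "boundary (\<zeta> - \<xi>) = boundary \<zeta> - boundary \<xi>"
  by (simp add: boundary_def frag_extend_diff)

lemma boundary_add: "boundary (\<zeta> + \<xi>) = boundary \<zeta> + boundary \<xi>"
  by (simp add: boundary_def frag_extend_add)

lemma boundary_minus: "boundary (- \<zeta>) = - boundary \<zeta>"
  by (simp add: boundary_def frag_extend_minus)

lemma boundary_0 [simp]: "boundary 0 = 0"
  by (simp add: boundary_def)

lemma boundary_frag_of: "boundary (frag_of c) = cell_boundary c"
  by (simp add: boundary_def)

lemma boundary_chains:
  fixes \<zeta> :: "'d::{finite,linorder} cell \<Rightarrow>\<^sub>0 int"
  assumes "\<zeta> \<in> chains (Suc d)"
  shows "boundary \<zeta> \<in> chains d"
  using assms
proof (induction \<zeta> rule: chains_induct)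
  case (cell x S)
  have "frag_cmul k (frag_of (x + axis i 1, S - {i}) - frag_of (x, S - {i})) \<in> chains d"
    if "i \<in> S" for i k
    using that cell keys_diff[of "frag_of (x + axis i 1, S - {i})" "frag_of (x, S - {i})"]
    by (auto simp: cells_def split: if_splits)
  then show ?case
    unfolding boundary_frag_of cell_boundary_def prod.case
    by (intro sum_closed_free_Abelian_group) auto
next
  case (diff \<zeta> \<xi>)
  then show ?case by (simp only: boundary_diff chains_diff)
qed simp

text \<open>The incidence signs depend only on the directions \<open>S\<close> and not on the base
  point, so the two operators commute on each cell.\<close>

lemma boundary_translate: "boundary (translate z \<zeta>) = translate z (boundary \<zeta>)"
proof -
  have "cell_boundary (x + z, S) = translate z (cell_boundary (x, S))" for x S
    by (simp add: cell_boundary_def translate_def frag_extend_sum frag_extend_cmul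
        frag_extend_diff o_def algebra_simps)
  then show ?thesis
    by (induction \<zeta> rule: frag_induction[OF subset_UNIV])
      (auto simp: boundary_diff translate_diff boundary_frag_of)
qed

lemma boundary_edge_cell: "boundary (frag_of (x, {i})) = vertex (x + axis i 1) - vertex x"
  by (simp add: boundary_frag_of cell_boundary_def vertex_def Collect_conv_if)

text \<open>No direction of the square precedes \<open>i\<close> and exactly one, namely
  \<open>i\<close>, precedes \<open>j\<close>; this gives the signs plus and minus.\<close>

lemma boundary_square_cell:
  fixes x :: "int ^ 'd::{finite,linorder}"
  assumes "i < j"
  shows "boundary (frag_of (x, {i, j})) =
    (frag_of (x + axis i 1, {j}) - frag_of (x, {j})) - (frag_of (x + axis j 1, {i}) - frag_of (x, {i}))"
proof -
  have cards: "{k. (k = i \<or> k = j) \<and> k < i} = {}" "{k. (k = i \<or> k = j) \<and> k < j} = {i}"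
    "{i, j} - {i} = {j}" "{i, j} - {j} = {i}" "i \<noteq> j"
    using assms by auto
  show ?thesis
    by (simp add: boundary_frag_of cell_boundary_def cards)
qed

text \<open>Each corner of a square occurs once with either sign. Dimension two is the case that
  governs closed 1-cochains.\<close>

lemma boundary_boundary_2:
  fixes \<zeta> :: "'d::{finite,linorder} cell \<Rightarrow>\<^sub>0 int"
  assumes "\<zeta> \<in> chains 2"
  shows "boundary (boundary \<zeta>) = 0"
  using assms
proof (induction \<zeta> rule: chains_induct)
  case (cell x S)
  then obtain i j where "S = {i, j}" "i < j"
    by (metis card_2_iff insert_commute linorder_neqE)
  then show ?case
    by (simp add: boundary_square_cell boundary_diff boundary_add boundary_edge_cell algebra_simps)
qed (simp_all add: boundary_diff)

section \<open>Edges and lattice paths\<close>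

lemma edge_eq:
  fixes x :: "int ^ 'd::finite"
  shows "edge x (x + axis i 1) = frag_of (x, {i})"
    and "edge (x + axis i 1) x = - frag_of (x, {i})"
proof -
  have inj: "axis i 1 = (axis j 1 :: int ^ 'd) \<longleftrightarrow> i = j" for i j
    by (auto simp: axis_eq_axis)
  have the: "(THE k. i = k) = i" for i :: 'd by blast
  show "edge x (x + axis i 1) = frag_of (x, {i})"
    by (auto simp: edge_def inj the)
  \<comment> \<open>Two unit vectors never add up to zero, so a backward edge fails the test for
    forward edges in \<open>edge\<close>.\<close>
  have "x \<noteq> x + axis i 1 + axis j 1" for j
  proof
    assume "x = x + axis i 1 + axis j 1"
    then have "(axis i 1 + axis j 1 :: int ^ 'd) = 0" by (simp add: add.assoc)
    from arg_cong[OF this, of "\<lambda>v. v $ i"] have "axis i (1::int) $ i + axis j 1 $ i = 0" by simp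
    then show False by (auto simp: axis_def split: if_splits)
  qed
  then show "edge (x + axis i 1) x = - frag_of (x, {i})"
    by (auto simp: edge_def inj the)
qed

lemma edge_chains: "adjacent x y \<Longrightarrow> edge x y \<in> chains 1"
  by (auto simp: adjacent_def edge_eq cells_def)

lemma boundary_edge: "adjacent x y \<Longrightarrow> boundary (edge x y) = vertex y - vertex x"
  by (auto simp: adjacent_def edge_eq boundary_minus boundary_edge_cell)

text \<open>The edge graph of the lattice is connected: a path to \<open>x\<close> is extended by
  adding the edge leaving \<open>x\<close> in direction \<open>i\<close>, or by subtracting the edge
  that arrives at \<open>x\<close> in that direction.\<close>

lemma lattice_path_exists:
  fixes z :: "int ^ 'd::{finite,linorder}"
  shows "\<exists>\<zeta>\<in>chains 1. boundary \<zeta> = vertex z - vertex 0"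
proof (induction z rule: lattice_induct)
  case zero
  show ?case by (intro bexI[of _ 0]) auto
next
  case (plus x i)
  then obtain \<zeta> where "\<zeta> \<in> chains 1" "boundary \<zeta> = vertex x - vertex 0" by blast
  then show ?case
    by (intro bexI[of _ "\<zeta> + frag_of (x, {i})"] chains_add)
      (auto simp: boundary_add boundary_edge_cell cells_def)
next
  case (minus x i)
  then obtain \<zeta> where "\<zeta> \<in> chains 1" "boundary \<zeta> = vertex x - vertex 0" by blast
  then show ?case
    by (intro bexI[of _ "\<zeta> - frag_of (x - axis i 1, {i})"] chains_diff)
      (auto simp: boundary_diff boundary_edge_cell cells_def)
qed

text \<open>An arbitrary choice of path, which closed cochains cannot detect by
  \<open>Z_eq_boundary_cong\<close>.\<close>

definition lattice_path :: "int ^ 'd::{finite,linorder} \<Rightarrow> ('d cell \<Rightarrow>\<^sub>0 int)" where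
  "lattice_path z = (SOME \<zeta>. \<zeta> \<in> chains 1 \<and> boundary \<zeta> = vertex z - vertex 0)"

lemma lattice_path_chains: "lattice_path z \<in> chains 1"
  and boundary_lattice_path: "boundary (lattice_path z) = vertex z - vertex 0"
  using someI_ex[OF lattice_path_exists[of z, unfolded Bex_def]] unfolding lattice_path_def
  by blast+

section \<open>Cochains and cocycles\<close>

lemma equivariant_cochain_iff:
  "equivariant_cochain d \<AA> C \<longleftrightarrow>
     (\<forall>\<zeta> a. \<not> (\<zeta> \<in> chains d \<and> a \<in> \<AA>) \<longrightarrow> C \<zeta> a = 0) \<and>
     (\<forall>\<zeta>\<in>chains d. continuous_map (subtopology config_space \<AA>) euclidean (C \<zeta>)) \<and>
     (\<forall>\<zeta>\<in>chains d. \<forall>\<xi>\<in>chains d. \<forall>a\<in>\<AA>. C (\<zeta> + \<xi>) a = C \<zeta> a + C \<xi> a) \<and>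
     (\<forall>\<zeta>\<in>chains d. \<forall>a\<in>\<AA>. \<forall>z. C \<zeta> (shift z a) = C (translate z \<zeta>) a)"
  unfolding equivariant_cochain_def continuous_map_prod_discrete_iff ..

lemma dynamical_cocycle_iff:
  "dynamical_cocycle \<AA> C \<longleftrightarrow>
     (\<forall>z a. a \<notin> \<AA> \<longrightarrow> C z a = 0) \<and>
     (\<forall>z. continuous_map (subtopology config_space \<AA>) euclidean (C z)) \<and>
     (\<forall>y z. \<forall>a\<in>\<AA>. C (y + z) a = C y (shift z a) + C z a)"
  unfolding dynamical_cocycle_def continuous_map_prod_discrete_iff by simp

text \<open>On \<open>\<AA>\<close> this is additivity for \<open>(\<zeta> - \<xi>) + \<xi>\<close>;
  elsewhere all three values are the default 0.\<close>

lemma equivariant_cochain_diff: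
  assumes "equivariant_cochain d \<AA> C" "\<zeta> \<in> chains d" "\<xi> \<in> chains d"
  shows "C (\<zeta> - \<xi>) a = C \<zeta> a - C \<xi> a"
proof (cases "a \<in> \<AA>")
  case True
  then have "C ((\<zeta> - \<xi>) + \<xi>) a = C (\<zeta> - \<xi>) a + C \<xi> a"
    using assms chains_diff[OF assms(2,3)] unfolding equivariant_cochain_iff by blast
  then show ?thesis by (simp add: algebra_simps)
next
  case False
  then show ?thesis using assms(1) unfolding equivariant_cochain_iff by simp
qed

lemma equivariant_cochain_add:
  assumes "equivariant_cochain d \<AA> C" "\<zeta> \<in> chains d" "\<xi> \<in> chains d"
  shows "C (\<zeta> + \<xi>) a = C \<zeta> a + C \<xi> a"
  using equivariant_cochain_diff[OF assms(1) chains_add[OF assms(2,3)] assms(3), of a]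
  by (simp add: algebra_simps)

lemma equivariant_cochain_0:
  assumes "equivariant_cochain d \<AA> C"
  shows "C 0 a = 0"
  using equivariant_cochain_diff[OF assms chains_0 chains_0] by simp

lemma equivariant_cochain_shift:
  "equivariant_cochain d \<AA> C \<Longrightarrow> \<zeta> \<in> chains d \<Longrightarrow> a \<in> \<AA> \<Longrightarrow>
     C \<zeta> (shift z a) = C (translate z \<zeta>) a"
  unfolding equivariant_cochain_iff by blast

lemma equivariant_cochain_eqI:
  assumes "equivariant_cochain d \<AA> C" "equivariant_cochain d \<AA> C'"
    and "\<And>x S a. card S = d \<Longrightarrow> a \<in> \<AA> \<Longrightarrow> C (frag_of (x, S)) a = C' (frag_of (x, S)) a"
  shows "C = C'"
proof (intro ext)
  fix \<zeta> a
  show "C \<zeta> a = C' \<zeta> a"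
  proof (cases "\<zeta> \<in> chains d \<and> a \<in> \<AA>")
    case True
    then have "\<zeta> \<in> chains d" by blast
    then show ?thesis
      by (induction \<zeta> rule: chains_induct)
        (use assms True in \<open>simp_all only: equivariant_cochain_diff equivariant_cochain_0\<close>)
  next
    case False
    then show ?thesis using assms(1,2) unfolding equivariant_cochain_iff by simp
  qed
qed

lemma equivariant_cochain_pointwise_diff:
  assumes "equivariant_cochain d \<AA> C" "equivariant_cochain d \<AA> C'"
  shows "equivariant_cochain d \<AA> (\<lambda>\<zeta> a. C \<zeta> a - C' \<zeta> a)"
  using assms unfolding equivariant_cochain_iff
  by (auto intro!: continuous_map_topological_diff)

lemma equivariant_cochain_zero: "equivariant_cochain d \<AA> (\<lambda>_ _. 0)"
  unfolding equivariant_cochain_iff by simp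

section \<open>Cochains from values on cells, and coboundaries\<close>

definition cochain_of ::
  "nat \<Rightarrow> ('a::finite, 'd::{finite,linorder}) config set
     \<Rightarrow> ('d cell \<Rightarrow> ('a, 'd) config \<Rightarrow> 'g::topological_ab_group_add) \<Rightarrow> ('a, 'd, 'g) chain_fun" where
  "cochain_of d \<AA> F = (\<lambda>\<zeta> a. if \<zeta> \<in> chains d \<and> a \<in> \<AA> then frag_lift (\<lambda>c. F c a) \<zeta> else 0)"

text \<open>Continuity and equivariance pass through differences of chains, so they need checking on
  cells only; additivity comes from \<open>frag_lift\<close>.\<close>

lemma equivariant_cochain_of:
  fixes \<AA> :: "('a::finite, 'd::{finite,linorder}) config set"
  assumes sub: "subshift \<AA>"
    and cont: "\<And>x S. card S = d \<Longrightarrow> continuous_map (subtopology config_space \<AA>) euclidean (F (x, S))"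
    and equi: "\<And>x S z a. card S = d \<Longrightarrow> a \<in> \<AA> \<Longrightarrow> F (x, S) (shift z a) = F (x + z, S) a"
  shows "equivariant_cochain d \<AA> (cochain_of d \<AA> F)"
  unfolding equivariant_cochain_iff
proof (intro conjI ballI allI impI)
  fix \<zeta> :: "'d cell \<Rightarrow>\<^sub>0 int" assume \<zeta>: "\<zeta> \<in> chains d"
  then have "continuous_map (subtopology config_space \<AA>) euclidean (\<lambda>a. frag_lift (\<lambda>c. F c a) \<zeta>)"
  proof (induction \<zeta> rule: chains_induct)
    case (cell x S)
    then show ?case using cont[of S x] by (simp add: eta_contract_eq)
  next
    case (diff \<zeta> \<xi>)
    then show ?case unfolding frag_lift_diff by (intro continuous_map_topological_diff)
  qed simp
  then show "continuous_map (subtopology config_space \<AA>) euclidean (cochain_of d \<AA> F \<zeta>)"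
    by (rule continuous_map_eq) (use \<zeta> in \<open>auto simp: cochain_of_def\<close>)
next
  fix \<zeta> :: "'d cell \<Rightarrow>\<^sub>0 int" and a z assume \<zeta>: "\<zeta> \<in> chains d" and a: "a \<in> \<AA>"
  have "frag_lift (\<lambda>c. F c (shift z a)) \<zeta> = frag_lift (\<lambda>c. F c a) (translate z \<zeta>)"
    using \<zeta> by (induction \<zeta> rule: chains_induct) (auto simp: equi[OF _ a] frag_lift_diff translate_diff)
  then show "cochain_of d \<AA> F \<zeta> (shift z a) = cochain_of d \<AA> F (translate z \<zeta>) a"
    using \<zeta> a shift_mem[OF sub a] translate_chains[OF \<zeta>] by (simp only: cochain_of_def simp_thms if_True)
next
  fix \<zeta> \<xi> :: "'d cell \<Rightarrow>\<^sub>0 int" and a assume *: "\<zeta> \<in> chains d" "\<xi> \<in> chains d" "a \<in> \<AA>"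
  then show "cochain_of d \<AA> F (\<zeta> + \<xi>) a = cochain_of d \<AA> F \<zeta> a + cochain_of d \<AA> F \<xi> a"
    using chains_add[OF *(1,2)] by (simp only: cochain_of_def frag_lift_add simp_thms if_True)
qed (auto simp: cochain_of_def)

text \<open>Every clause is inherited from \<open>C\<close>, because the boundary is additive,
  lowers the dimension by one and commutes with translation.\<close>

lemma equivariant_cochain_coboundary:
  fixes C :: "('a::finite, 'd::{finite,linorder}, 'g::topological_ab_group_add) chain_fun"
  assumes sub: "subshift \<AA>" and C: "equivariant_cochain d \<AA> C"
  shows "equivariant_cochain (Suc d) \<AA> (coboundary d \<AA> C)"
  unfolding equivariant_cochain_iff
proof (intro conjI ballI allI impI)
  fix \<zeta> :: "'d cell \<Rightarrow>\<^sub>0 int" assume \<zeta>: "\<zeta> \<in> chains (Suc d)"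
  have "continuous_map (subtopology config_space \<AA>) euclidean (C (boundary \<zeta>))"
    using C boundary_chains[OF \<zeta>] unfolding equivariant_cochain_iff by blast
  then show "continuous_map (subtopology config_space \<AA>) euclidean (coboundary d \<AA> C \<zeta>)"
    by (rule continuous_map_eq) (use \<zeta> in \<open>auto simp: coboundary_def\<close>)
next
  fix \<zeta> \<xi> :: "'d cell \<Rightarrow>\<^sub>0 int" and a
  assume *: "\<zeta> \<in> chains (Suc d)" "\<xi> \<in> chains (Suc d)" "a \<in> \<AA>"
  have "C (boundary \<zeta> + boundary \<xi>) a = C (boundary \<zeta>) a + C (boundary \<xi>) a"
    using * by (intro equivariant_cochain_add[OF C] boundary_chains)
  then show "coboundary d \<AA> C (\<zeta> + \<xi>) a = coboundary d \<AA> C \<zeta> a + coboundary d \<AA> C \<xi> a"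
    using * chains_add[OF *(1,2)] by (simp only: coboundary_def boundary_add simp_thms if_True)
next
  fix \<zeta> :: "'d cell \<Rightarrow>\<^sub>0 int" and a z assume *: "\<zeta> \<in> chains (Suc d)" "a \<in> \<AA>"
  show "coboundary d \<AA> C \<zeta> (shift z a) = coboundary d \<AA> C (translate z \<zeta>) a"
    using * shift_mem[OF sub *(2)] translate_chains[OF *(1)]
      equivariant_cochain_shift[OF C boundary_chains[OF *(1)] *(2)]
    by (simp only: coboundary_def boundary_translate simp_thms if_True)
qed (auto simp: coboundary_def)

lemma Z_eq_carrier:
  "C \<in> carrier (Z_eq d \<AA>) \<longleftrightarrow>
     equivariant_cochain d \<AA> C \<and> (\<forall>\<zeta>\<in>chains (Suc d). \<forall>a\<in>\<AA>. C (boundary \<zeta>) a = 0)"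
  by (auto simp: Z_eq_def C_eq_def kernel_def coboundary_def fun_eq_iff)

lemma Z_dy_carrier: "C \<in> carrier (Z_dy \<AA>) \<longleftrightarrow> dynamical_cocycle \<AA> C"
  by (simp add: Z_dy_def)

section \<open>Closed 1-cochains and independence of the path\<close>

text \<open>For fixed \<open>a\<close>, vanishing on boundaries of squares is the compatibility that
  \<open>lattice_potential\<close> asks of the edge values; additivity extends the formula from
  edges to chains. The potential is chosen separately for each \<open>a\<close>.\<close>

lemma Z_eq_potential:
  fixes C :: "('a::finite, 'd::{finite,linorder}, 'g::topological_ab_group_add) chain_fun"
  assumes C: "C \<in> carrier (Z_eq 1 \<AA>)" and a: "a \<in> \<AA>"
  obtains f where "\<And>\<zeta>. \<zeta> \<in> chains 1 \<Longrightarrow> C \<zeta> a = frag_lift (\<lambda>(x, _). f x) (boundary \<zeta>)"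
proof -
  have eq: "equivariant_cochain 1 \<AA> C"
    and cl: "\<And>\<zeta>. \<zeta> \<in> chains 2 \<Longrightarrow> C (boundary \<zeta>) a = 0"
    using C a by (auto simp: Z_eq_carrier numeral_2_eq_2)
  define c where "c x i = C (frag_of (x, {i})) a" for x i
  have edge: "frag_of (x, {i}) \<in> chains 1" for x :: "int ^ 'd::{finite,linorder}" and i
    by (simp add: cells_def)
  have square: "c x i + c (x + axis i 1) j = c x j + c (x + axis j 1) i" if "i < j" for x i j
  proof -
    have "frag_of (x, {i, j}) \<in> chains 2"
      using that by (simp add: cells_def)
    from cl[OF this] show ?thesis
      unfolding boundary_square_cell[OF that]
      by (simp only: equivariant_cochain_diff[OF eq] edge chains_diff c_def)
        (simp add: algebra_simps)
  qed
  \<comment> \<open>For \<open>i = j\<close> both sides agree, and for \<open>j < i\<close> this is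
    the square relation with the two directions exchanged.\<close>
  have "c x i + c (x + axis i 1) j = c x j + c (x + axis j 1) i" for x i j
    using square[of i j x] square[of j i x] by (cases i j rule: linorder_cases) auto
  then obtain f where f: "\<And>x i. f (x + axis i 1) - f x = c x i"
    using lattice_potential by blast
  have "C \<zeta> a = frag_lift (\<lambda>(x, _). f x) (boundary \<zeta>)" if "\<zeta> \<in> chains 1" for \<zeta>
    using that
  proof (induction \<zeta> rule: chains_induct)
    case zero
    show ?case by (simp add: equivariant_cochain_0[OF eq])
  next
    case (cell x S)
    then obtain i where "S = {i}" by (auto simp: card_1_singleton_iff)
    then show ?case
      using f[of x i] by (simp add: boundary_edge_cell frag_lift_diff vertex_def c_def)
  next
    case (diff \<zeta> \<xi>)
    then show ?case
      by (simp only: equivariant_cochain_diff[OF eq] boundary_diff frag_lift_diff)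
  qed
  then show thesis by (rule that)
qed

text \<open>Both values equal the potential evaluated on the common boundary: this is path
  independence.\<close>

lemma Z_eq_boundary_cong:
  assumes "C \<in> carrier (Z_eq 1 \<AA>)" "\<zeta> \<in> chains 1" "\<xi> \<in> chains 1" "boundary \<zeta> = boundary \<xi>"
  shows "C \<zeta> a = C \<xi> a"
proof (cases "a \<in> \<AA>")
  case True
  then show ?thesis using Z_eq_potential[OF assms(1) True] assms(2-4) by metis
next
  case False
  then show ?thesis using assms(1) by (simp add: Z_eq_carrier equivariant_cochain_iff)
qed

section \<open>The correspondence between closed cochains and dynamical cocycles\<close>

definition cocycle_of :: "('a, 'd::{finite,linorder}, 'g) chain_fun \<Rightarrow> ('a, 'd, 'g) lattice_fun" where
  "cocycle_of C = (\<lambda>z. C (lattice_path z))"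

lemma cocycle_of_eq:
  assumes "C \<in> carrier (Z_eq 1 \<AA>)" "\<zeta> \<in> chains 1" "boundary \<zeta> = vertex z - vertex 0"
  shows "cocycle_of C z a = C \<zeta> a"
  unfolding cocycle_of_def
  using assms by (intro Z_eq_boundary_cong lattice_path_chains) (simp_all only: boundary_lattice_path)

text \<open>The chosen path from 0 to \<open>y - x\<close>, translated by \<open>x\<close>, has the
  same boundary as the edge, and equivariance trades the translation for a shift of
  \<open>a\<close>.\<close>

lemma cocycle_of_edge:
  assumes C: "C \<in> carrier (Z_eq 1 \<AA>)" and "adjacent x y" and a: "a \<in> \<AA>"
  shows "C (edge x y) a = cocycle_of C (y - x) (shift x a)"
proof -
  have eq: "equivariant_cochain 1 \<AA> C" using C by (simp add: Z_eq_carrier)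
  have "cocycle_of C (y - x) (shift x a) = C (translate x (lattice_path (y - x))) a"
    unfolding cocycle_of_def by (rule equivariant_cochain_shift[OF eq lattice_path_chains a])
  also have "\<dots> = C (edge x y) a"
    using assms
    by (intro Z_eq_boundary_cong translate_chains lattice_path_chains edge_chains)
      (simp_all add: boundary_translate boundary_lattice_path boundary_edge translate_diff
        translate_vertex)
  finally show ?thesis ..
qed

lemma cocycle_of_edge_cell:
  assumes "C \<in> carrier (Z_eq 1 \<AA>)" "a \<in> \<AA>"
  shows "C (frag_of (x, {i})) a = cocycle_of C (axis i 1) (shift x a)"
  using cocycle_of_edge[OF assms(1) _ assms(2), of x "x + axis i 1"]
  by (auto simp: edge_eq adjacent_def)

lemma dynamical_cocycle_cocycle_of:
  fixes C :: "('a::finite, 'd::{finite,linorder}, 'g::topological_ab_group_add) chain_fun"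
  assumes C: "C \<in> carrier (Z_eq 1 \<AA>)"
  shows "dynamical_cocycle \<AA> (cocycle_of C)"
  unfolding dynamical_cocycle_iff
proof (intro conjI allI ballI impI)
  have eq: "equivariant_cochain 1 \<AA> C" using C by (simp add: Z_eq_carrier)
  show "cocycle_of C z a = 0" if "a \<notin> \<AA>" for z a
    using eq that unfolding equivariant_cochain_iff cocycle_of_def by blast
  show "continuous_map (subtopology config_space \<AA>) euclidean (cocycle_of C z)" for z
    using eq lattice_path_chains unfolding equivariant_cochain_iff cocycle_of_def by blast
  fix y z :: "int ^ 'd::{finite,linorder}" and a assume a: "a \<in> \<AA>"
  have tr: "translate z (lattice_path y) \<in> chains 1"
    by (rule translate_chains[OF lattice_path_chains])
  \<comment> \<open>The path to \<open>z\<close>, followed by the path to \<open>y\<close> moved by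
    \<open>z\<close>, leads from 0 to \<open>y + z\<close>.\<close>
  have "cocycle_of C (y + z) a = C (translate z (lattice_path y) + lattice_path z) a"
    using C
    by (intro cocycle_of_eq chains_add tr lattice_path_chains)
      (simp_all add: boundary_add boundary_translate boundary_lattice_path translate_diff
        translate_vertex)
  also have "\<dots> = C (translate z (lattice_path y)) a + C (lattice_path z) a"
    by (rule equivariant_cochain_add[OF eq tr lattice_path_chains])
  also have "\<dots> = cocycle_of C y (shift z a) + cocycle_of C z a"
    using equivariant_cochain_shift[OF eq lattice_path_chains a] by (simp add: cocycle_of_def)
  finally show "cocycle_of C (y + z) a = cocycle_of C y (shift z a) + cocycle_of C z a" .
qed

text \<open>On an edge cell \<open>S\<close> is a singleton \<open>{i}\<close>, and the sum is a way
  of writing \<open>axis i 1\<close> without selecting the element of \<open>S\<close>.\<close>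

definition cochain_of_cocycle ::
  "('a::finite, 'd::{finite,linorder}) config set
     \<Rightarrow> ('a, 'd, 'g::topological_ab_group_add) lattice_fun \<Rightarrow> ('a, 'd, 'g) chain_fun" where
  "cochain_of_cocycle \<AA> D = cochain_of 1 \<AA> (\<lambda>(x, S) a. D (\<Sum>i\<in>S. axis i 1) (shift x a))"

text \<open>By the cocycle identity the function \<open>\<lambda>x. D x a\<close> is a potential for
  the edge values. Closedness and the inverse property are both read off from this formula.\<close>

lemma cochain_of_cocycle_eq:
  assumes D: "dynamical_cocycle \<AA> D" and \<zeta>: "\<zeta> \<in> chains 1" and a: "a \<in> \<AA>"
  shows "cochain_of_cocycle \<AA> D \<zeta> a = frag_lift (\<lambda>(x, _). D x a) (boundary \<zeta>)"
proof -
  have "frag_lift (\<lambda>c. (\<lambda>(x, S) a. D (\<Sum>i\<in>S. axis i 1) (shift x a)) c a) \<zeta>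
      = frag_lift (\<lambda>(x, _). D x a) (boundary \<zeta>)"
    using \<zeta>
  proof (induction \<zeta> rule: chains_induct)
    case (cell x S)
    then obtain i where "S = {i}" by (auto simp: card_1_singleton_iff)
    moreover have "D (x + axis i 1) a = D (axis i 1) (shift x a) + D x a"
      using D a unfolding dynamical_cocycle_iff by (metis add.commute)
    ultimately show ?case
      by (simp add: boundary_edge_cell frag_lift_diff vertex_def)
  qed (simp_all add: boundary_diff frag_lift_diff)
  then show ?thesis
    using \<zeta> a by (simp only: cochain_of_cocycle_def cochain_of_def simp_thms if_True)
qed

text \<open>The cocycle identity is already absorbed in the potential formula, which on a boundary
  evaluates the boundary of a boundary, that is, 0.\<close>

lemma cochain_of_cocycle_Z_eq:
  fixes \<AA> :: "('a::finite, 'd::{finite,linorder}) config set"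
  assumes sub: "subshift \<AA>" and D: "dynamical_cocycle \<AA> D"
  shows "cochain_of_cocycle \<AA> D \<in> carrier (Z_eq 1 \<AA>)"
  unfolding Z_eq_carrier
proof (intro conjI ballI)
  show "equivariant_cochain 1 \<AA> (cochain_of_cocycle \<AA> D)"
    unfolding cochain_of_cocycle_def
    using D
    by (intro equivariant_cochain_of[OF sub])
      (auto simp: dynamical_cocycle_iff intro!: continuous_map_compose_shift[OF sub])
  fix \<zeta> :: "'d cell \<Rightarrow>\<^sub>0 int" and a assume "\<zeta> \<in> chains (Suc 1)" "a \<in> \<AA>"
  then show "cochain_of_cocycle \<AA> D (boundary \<zeta>) a = 0"
    using boundary_chains[of \<zeta> 1] boundary_boundary_2[of \<zeta>]
    by (simp only: cochain_of_cocycle_eq[OF D] frag_lift_0 Suc_1)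
qed

lemma cocycle_of_cochain_of_cocycle:
  assumes sub: "subshift \<AA>" and D: "dynamical_cocycle \<AA> D"
  shows "cocycle_of (cochain_of_cocycle \<AA> D) = D"
proof (intro ext)
  fix z a
  show "cocycle_of (cochain_of_cocycle \<AA> D) z a = D z a"
  proof (cases "a \<in> \<AA>")
    case True
    \<comment> \<open>The potential on \<open>vertex z - vertex 0\<close> gives
      \<open>D z a - D 0 a\<close>, so the constant \<open>D 0 a\<close> has to vanish.\<close>
    have "D (0 + 0) a = D 0 (shift 0 a) + D 0 a"
      using D True unfolding dynamical_cocycle_iff by blast
    then have "D 0 a = 0" by simp
    then show ?thesis
      unfolding cocycle_of_def
      by (simp only: cochain_of_cocycle_eq[OF D lattice_path_chains True] boundary_lattice_path
          frag_lift_diff vertex_def frag_lift_of prod.case diff_zero)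
  next
    case False
    then show ?thesis
      using D by (simp add: cocycle_of_def cochain_of_cocycle_def cochain_of_def dynamical_cocycle_iff)
  qed
qed

text \<open>A 1-cochain is determined by its edge values, and \<open>cocycle_of_edge_cell\<close>
  recovers these from the cocycle.\<close>

lemma cocycle_of_inj:
  fixes C :: "('a::finite, 'd::{finite,linorder}, 'g::topological_ab_group_add) chain_fun"
  assumes C: "C \<in> carrier (Z_eq 1 \<AA>)" "C' \<in> carrier (Z_eq 1 \<AA>)" and "cocycle_of C = cocycle_of C'"
  shows "C = C'"
proof (rule equivariant_cochain_eqI[of 1 \<AA>])
  fix x a and S :: "'d set" assume "card S = 1" "a \<in> \<AA>"
  then show "C (frag_of (x, S)) a = C' (frag_of (x, S)) a"
    using assms by (auto simp: card_1_singleton_iff cocycle_of_edge_cell)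
qed (use C in \<open>auto simp: Z_eq_carrier\<close>)

section \<open>Quotient groups\<close>

text \<open>The first isomorphism theorem, together with the value on each coset, by which the
  comparison maps are later described.\<close>

lemma (in group_hom) FactGroup_induced_iso:
  assumes "h ` carrier G = carrier H"
  obtains g where "g \<in> iso (G Mod kernel G H h) H"
    "\<And>x. x \<in> carrier G \<Longrightarrow> g (kernel G H h #> x) = h x"
proof
  show "(\<lambda>X. the_elem (h ` X)) \<in> iso (G Mod kernel G H h) H"
    by (rule FactGroup_iso_set[OF assms])
  fix x assume x: "x \<in> carrier G"
  then have "x \<in> kernel G H h #> x"
    by (rule G.rcos_self[OF _ subgroup_kernel])
  moreover have "h y = h x" if "y \<in> kernel G H h #> x" for y
  proof -
    from that obtain k where "k \<in> carrier G" "h k = \<one>\<^bsub>H\<^esub>" "y = k \<otimes> x"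
      unfolding r_coset_def kernel_def by blast
    with x show ?thesis by simp
  qed
  ultimately have "h ` (kernel G H h #> x) = {h x}" by blast
  then show "the_elem (h ` (kernel G H h #> x)) = h x" by simp
qed

text \<open>The isomorphism followed by the projection; surjectivity and the kernel are what the
  first isomorphism theorem needs to move a quotient of \<open>H\<close> to one of
  \<open>G\<close>.\<close>

lemma iso_Mod_hom:
  assumes "group G" "\<phi> \<in> iso G H" "K \<lhd> H"
  defines "h \<equiv> \<lambda>x. K #>\<^bsub>H\<^esub> \<phi> x"
  shows "group_hom G (H Mod K) h"
    and "h ` carrier G = carrier (H Mod K)"
    and "kernel G (H Mod K) h = {x \<in> carrier G. \<phi> x \<in> K}"
proof -
  interpret K: normal K H by fact
  have "(\<lambda>a. K #>\<^bsub>H\<^esub> a) \<circ> \<phi> \<in> hom G (H Mod K)"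
    using assms(2) K.r_coset_hom_Mod by (intro Group.hom_compose) (auto simp: iso_def)
  then show "group_hom G (H Mod K) h"
    using \<open>group G\<close> K.factorgroup_is_group
    by (simp add: group_hom_def group_hom_axioms_def h_def o_def)
  have img: "\<phi> ` carrier G = carrier H"
    using assms(2) by (auto simp: iso_def bij_betw_def)
  then show "h ` carrier G = carrier (H Mod K)"
    unfolding h_def carrier_FactGroup by (metis image_image)
  have "K #>\<^bsub>H\<^esub> \<phi> x = K \<longleftrightarrow> \<phi> x \<in> K" if "x \<in> carrier G" for x
    using img that K.subgroup_axioms K.coset_join1 K.coset_join2 by blast
  then show "kernel G (H Mod K) h = {x \<in> carrier G. \<phi> x \<in> K}"
    by (auto simp: kernel_def h_def)
qed

text \<open>As \<open>M\<close> is the preimage of \<open>N\<close>, the first isomorphism theorem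
  gives \<open>\<Psi>\<close>. The map to \<open>H Mod N'\<close> factors through
  \<open>G Mod M\<close>, the condition on \<open>T\<close> identifies the kernel of the factor with
  the classes of \<open>T\<close>, and a second application gives \<open>\<Theta>\<close>.\<close>

lemma quotient_isos:
  assumes G: "comm_group G" and H: "comm_group H" and \<phi>: "\<phi> \<in> iso G H"
    and N: "subgroup N H" "subgroup N' H" "N \<subseteq> N'"
    and M: "M = {x \<in> carrier G. \<phi> x \<in> N}"
    and T: "T \<subseteq> carrier G"
    and N': "\<And>x. x \<in> carrier G \<Longrightarrow> \<phi> x \<in> N' \<longleftrightarrow> (\<exists>t\<in>T. x \<in> M #>\<^bsub>G\<^esub> t)"
  obtains \<Psi> \<Theta> where
    "\<Psi> \<in> iso (G Mod M) (H Mod N)"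
    "\<And>x. x \<in> carrier G \<Longrightarrow> \<Psi> (M #>\<^bsub>G\<^esub> x) = N #>\<^bsub>H\<^esub> \<phi> x"
    "\<Theta> \<in> iso (G Mod M Mod ((\<lambda>t. M #>\<^bsub>G\<^esub> t) ` T)) (H Mod N')"
    "\<And>x. x \<in> carrier G \<Longrightarrow>
       \<Theta> (((\<lambda>t. M #>\<^bsub>G\<^esub> t) ` T) #>\<^bsub>G Mod M\<^esub> (M #>\<^bsub>G\<^esub> x)) = N' #>\<^bsub>H\<^esub> \<phi> x"
proof -
  interpret G: comm_group G by fact
  interpret H: comm_group H by fact
  note q = iso_Mod_hom[OF G.group_axioms \<phi> H.subgroup_imp_normal[OF N(1)]]
  note q' = iso_Mod_hom[OF G.group_axioms \<phi> H.subgroup_imp_normal[OF N(2)]]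
  interpret h: group_hom G "H Mod N" "\<lambda>x. N #>\<^bsub>H\<^esub> \<phi> x" by (rule q)
  interpret h': group_hom G "H Mod N'" "\<lambda>x. N' #>\<^bsub>H\<^esub> \<phi> x" by (rule q')
  obtain \<Psi> where \<Psi>: "\<Psi> \<in> iso (G Mod M) (H Mod N)"
    "\<And>x. x \<in> carrier G \<Longrightarrow> \<Psi> (M #>\<^bsub>G\<^esub> x) = N #>\<^bsub>H\<^esub> \<phi> x"
    using h.FactGroup_induced_iso[OF q(2)] unfolding q(3) M by blast
  have "M \<lhd> G" using h.normal_kernel unfolding q(3) M .
  interpret M: normal M G by fact
  have "M \<subseteq> kernel G (H Mod N') (\<lambda>x. N' #>\<^bsub>H\<^esub> \<phi> x)"
    unfolding q'(3) M using \<open>N \<subseteq> N'\<close> by blast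
  then obtain g where g: "g \<in> hom (G Mod M) (H Mod N')"
    "\<And>x. x \<in> carrier G \<Longrightarrow> g (M #>\<^bsub>G\<^esub> x) = N' #>\<^bsub>H\<^esub> \<phi> x"
    using h'.FactGroup_universal_kernel[OF \<open>M \<lhd> G\<close>] by blast
  interpret g: group_hom "G Mod M" "H Mod N'" g
    using g(1) M.factorgroup_is_group q'(1) by (simp add: group_hom_def group_hom_axioms_def)
  have "N' #>\<^bsub>H\<^esub> \<phi> x = N' \<longleftrightarrow> \<phi> x \<in> N'" if "x \<in> carrier G" for x
    using q'(3) that unfolding kernel_def one_FactGroup by blast
  then have "kernel (G Mod M) (H Mod N') g = {M #>\<^bsub>G\<^esub> x | x. x \<in> carrier G \<and> \<phi> x \<in> N'}"
    unfolding kernel_def carrier_FactGroup one_FactGroup using g(2) by blast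
  \<comment> \<open>An \<open>x\<close> lying in the coset of \<open>t\<close> has the same coset as
    \<open>t\<close>; conversely each \<open>t\<close> lies in its own coset.\<close>
  also have "\<dots> = (\<lambda>t. M #>\<^bsub>G\<^esub> t) ` T"
  proof (intro equalityI subsetI)
    fix X assume "X \<in> {M #>\<^bsub>G\<^esub> x | x. x \<in> carrier G \<and> \<phi> x \<in> N'}"
    then obtain x t where "X = M #>\<^bsub>G\<^esub> x" "t \<in> T" "x \<in> M #>\<^bsub>G\<^esub> t" using N' by blast
    then show "X \<in> (\<lambda>t. M #>\<^bsub>G\<^esub> t) ` T"
      using T G.repr_independence[OF _ _ M.subgroup_axioms] by blast
  next
    fix X assume "X \<in> (\<lambda>t. M #>\<^bsub>G\<^esub> t) ` T"
    then obtain t where t: "t \<in> T" "t \<in> carrier G" "X = M #>\<^bsub>G\<^esub> t" using T by blast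
    then have "\<phi> t \<in> N'" using N' G.rcos_self[OF _ M.subgroup_axioms] by blast
    with t show "X \<in> {M #>\<^bsub>G\<^esub> x | x. x \<in> carrier G \<and> \<phi> x \<in> N'}" by blast
  qed
  finally have ker: "kernel (G Mod M) (H Mod N') g = (\<lambda>t. M #>\<^bsub>G\<^esub> t) ` T" .
  have "g ` carrier (G Mod M) = carrier (H Mod N')"
    unfolding q'(2)[symmetric] carrier_FactGroup[of G] image_image using g(2) by (intro image_cong refl)
  from g.FactGroup_induced_iso[OF this] obtain \<Theta> where
    "\<Theta> \<in> iso (G Mod M Mod ((\<lambda>t. M #>\<^bsub>G\<^esub> t) ` T)) (H Mod N')"
    "\<And>X. X \<in> carrier (G Mod M) \<Longrightarrow> \<Theta> (((\<lambda>t. M #>\<^bsub>G\<^esub> t) ` T) #>\<^bsub>G Mod M\<^esub> X) = g X"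
    unfolding ker by blast
  with \<Psi> g(2) show thesis
    unfolding carrier_FactGroup by (intro that) (assumption | simp only: imageI)+
qed

section \<open>Groups of functions under pointwise addition\<close>

definition pointwise_group :: "('x \<Rightarrow> 'y \<Rightarrow> 'g::ab_group_add) set \<Rightarrow> ('x \<Rightarrow> 'y \<Rightarrow> 'g) monoid" where
  "pointwise_group S =
     \<lparr>carrier = S, monoid.mult = (\<lambda>f g. \<lambda>x y. f x y + g x y), monoid.one = (\<lambda>_ _. 0)\<rparr>"

text \<open>The subgroup criterion by differences: the one condition verified for closed cochains,
  for dynamical cocycles and for the two subgroups on the dynamical side.\<close>

definition diff_closed :: "('x \<Rightarrow> 'y \<Rightarrow> 'g::ab_group_add) set \<Rightarrow> bool" where
  "diff_closed S \<longleftrightarrow> (\<lambda>_ _. 0) \<in> S \<and> (\<forall>f\<in>S. \<forall>g\<in>S. (\<lambda>x y. f x y - g x y) \<in> S)"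

lemma comm_group_pointwise_group:
  assumes "diff_closed S"
  shows "comm_group (pointwise_group S)"
proof -
  have zero: "(\<lambda>_ _. 0) \<in> S" and diff: "\<And>f g. f \<in> S \<Longrightarrow> g \<in> S \<Longrightarrow> (\<lambda>x y. f x y - g x y) \<in> S"
    using assms by (auto simp: diff_closed_def)
  have minus: "(\<lambda>x y. - f x y) \<in> S" if "f \<in> S" for f
    using diff[OF zero that] by simp
  have add: "(\<lambda>x y. f x y + g x y) \<in> S" if "f \<in> S" "g \<in> S" for f g
    using diff[OF that(1) minus[OF that(2)]] by simp
  show ?thesis
  proof (rule comm_groupI)
    fix f assume "f \<in> carrier (pointwise_group S)"
    then show "\<exists>g\<in>carrier (pointwise_group S). g \<otimes>\<^bsub>pointwise_group S\<^esub> f = \<one>\<^bsub>pointwise_group S\<^esub>"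
      by (intro bexI[of _ "\<lambda>x y. - f x y"]) (auto simp: pointwise_group_def minus)
  qed (auto simp: pointwise_group_def zero add algebra_simps)
qed

lemma subgroup_pointwise_group:
  assumes "diff_closed S" "B \<subseteq> S" "diff_closed B"
  shows "subgroup B (pointwise_group S)"
proof -
  interpret S: comm_group "pointwise_group S" by (rule comm_group_pointwise_group) fact
  interpret B: comm_group "pointwise_group B" by (rule comm_group_pointwise_group) fact
  have "(pointwise_group S)\<lparr>carrier := B\<rparr> = pointwise_group B"
    by (simp add: pointwise_group_def)
  then show ?thesis
    using \<open>B \<subseteq> S\<close> B.group_axioms
    by (intro S.group_incl_imp_subgroup) (auto simp: pointwise_group_def)
qed


section \<open>Comparison of the cohomology groups\<close>

lemma Z_eq_pointwise: "Z_eq d \<AA> = pointwise_group (carrier (Z_eq d \<AA>))"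
  by (simp add: Z_eq_def C_eq_def pointwise_group_def)

lemma Z_dy_pointwise: "Z_dy \<AA> = pointwise_group (carrier (Z_dy \<AA>))"
  by (simp add: Z_dy_def pointwise_group_def)

section \<open>Closure under differences\<close>

lemma diff_closed_Z_eq: "diff_closed (carrier (Z_eq d \<AA>))"
  unfolding diff_closed_def Ball_def Z_eq_carrier
  by (auto intro: equivariant_cochain_zero equivariant_cochain_pointwise_diff)

lemma dynamical_cocycle_diff:
  "dynamical_cocycle \<AA> C \<Longrightarrow> dynamical_cocycle \<AA> D \<Longrightarrow> dynamical_cocycle \<AA> (\<lambda>z a. C z a - D z a)"
  unfolding dynamical_cocycle_iff by (auto intro!: continuous_map_topological_diff)

lemma dynamical_cocycle_zero: "dynamical_cocycle \<AA> (\<lambda>_ _. 0)"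
  unfolding dynamical_cocycle_iff by simp

lemma diff_closed_Z_dy: "diff_closed (carrier (Z_dy \<AA>))"
  unfolding diff_closed_def Ball_def Z_dy_carrier
  by (auto intro: dynamical_cocycle_zero dynamical_cocycle_diff)

lemma cohomologous_diff:
  assumes "cohomologous \<AA> C C'" "cohomologous \<AA> D D'"
  shows "cohomologous \<AA> (\<lambda>z a. C z a - D z a) (\<lambda>z a. C' z a - D' z a)"
proof -
  obtain B B' where
    B: "continuous_map (subtopology config_space \<AA>) euclidean B"
      "\<And>z a. a \<in> \<AA> \<Longrightarrow> C' z a = B (shift z a) + C z a - B a"
    and B': "continuous_map (subtopology config_space \<AA>) euclidean B'"
      "\<And>z a. a \<in> \<AA> \<Longrightarrow> D' z a = B' (shift z a) + D z a - B' a"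
    using assms unfolding cohomologous_def by blast
  show ?thesis
    unfolding cohomologous_def
    using continuous_map_topological_diff[OF B(1) B'(1)]
    by (intro exI[of _ "\<lambda>a. B a - B' a"]) (auto simp: B(2) B'(2))
qed

lemma cohomologous_refl: "cohomologous \<AA> C C"
  unfolding cohomologous_def by (intro exI[of _ "\<lambda>_. 0"]) simp

lemma diff_closed_B_dy: "diff_closed (B_dy \<AA>)"
  using diff_closed_Z_dy[of \<AA>] cohomologous_refl cohomologous_diff[of \<AA> "\<lambda>_ _. 0" _ "\<lambda>_ _. 0"]
  by (auto simp: diff_closed_def B_dy_def)

lemma diff_closed_B_dy_triv:
  "diff_closed (B_dy_triv \<AA> :: ('a::finite, 'd::finite, 'g::topological_ab_group_add) lattice_fun set)"
  unfolding diff_closed_def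
proof (intro conjI ballI)
  show "(\<lambda>_ _. 0) \<in> B_dy_triv \<AA>"
    using diff_closed_Z_dy[of \<AA>] cohomologous_refl[of \<AA> "\<lambda>_ _. 0"]
    by (auto simp: B_dy_triv_def diff_closed_def intro!: exI[of _ "\<lambda>_. 0"])
  fix C D :: "('a, 'd, 'g) lattice_fun"
  assume *: "C \<in> B_dy_triv \<AA>" "D \<in> B_dy_triv \<AA>"
  then obtain h k where
    h: "\<And>y z. h (y + z) = h y + h z" "cohomologous \<AA> (\<lambda>z _. h z) C"
    and k: "\<And>y z. k (y + z) = k y + k z" "cohomologous \<AA> (\<lambda>z _. k z) D"
    unfolding B_dy_triv_def by blast
  have "(\<lambda>z a. C z a - D z a) \<in> carrier (Z_dy \<AA>)"
    using * diff_closed_Z_dy[of \<AA>] unfolding B_dy_triv_def diff_closed_def by blast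
  moreover have "cohomologous \<AA> (\<lambda>z _. h z - k z) (\<lambda>z a. C z a - D z a)"
    by (rule cohomologous_diff[OF h(2) k(2)])
  ultimately show "(\<lambda>z a. C z a - D z a) \<in> B_dy_triv \<AA>"
    unfolding B_dy_triv_def using h(1) k(1) by (auto intro!: exI[of _ "\<lambda>z. h z - k z"])
qed

section \<open>The isomorphism and the subgroups it matches\<close>

text \<open>The same path to \<open>z\<close> serves all cochains, which makes the map additive;
  \<open>cochain_of_cocycle\<close> is a right inverse.\<close>

lemma cocycle_of_iso:
  assumes sub: "subshift \<AA>"
  shows "cocycle_of \<in> iso (Z_eq 1 \<AA>)
    (Z_dy \<AA> :: ('a::finite, 'd::{finite,linorder}, 'g::topological_ab_group_add) lattice_fun monoid)"
    (is "_ \<in> iso ?G ?H")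
  unfolding iso_def bij_betw_def
proof (intro CollectI conjI)
  show "cocycle_of \<in> hom ?G ?H"
  proof (rule homI)
    show "cocycle_of (C \<otimes>\<^bsub>?G\<^esub> C') = cocycle_of C \<otimes>\<^bsub>?H\<^esub> cocycle_of C'" for C C'
      by (simp add: cocycle_of_def Z_eq_def C_eq_def Z_dy_def)
  qed (simp add: dynamical_cocycle_cocycle_of Z_dy_carrier)
  show "inj_on cocycle_of (carrier ?G)"
    by (intro inj_onI cocycle_of_inj)
  show "cocycle_of ` carrier ?G = carrier ?H"
  proof (intro equalityI subsetI)
    fix D assume "D \<in> carrier ?H"
    then have D: "dynamical_cocycle \<AA> D" by (simp only: Z_dy_carrier)
    show "D \<in> cocycle_of ` carrier ?G"
      using cocycle_of_cochain_of_cocycle[OF sub D] cochain_of_cocycle_Z_eq[OF sub D]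
      by (metis imageI)
  qed (auto simp: Z_dy_carrier dynamical_cocycle_cocycle_of)
qed

text \<open>A 0-cochain amounts to a function \<open>B\<close> of configurations: its value at the
  origin is \<open>B a\<close>, and equivariance forces \<open>B (shift x a)\<close> at the vertex
  \<open>x\<close>. Its coboundary along a path to \<open>z\<close> is then the difference with
  transfer function \<open>B\<close>.\<close>

lemma B_eq_iff:
  fixes C :: "('a::finite, 'd::{finite,linorder}, 'g::topological_ab_group_add) chain_fun"
  assumes sub: "subshift \<AA>"
  shows "C \<in> B_eq 1 \<AA> \<longleftrightarrow> C \<in> carrier (Z_eq 1 \<AA>) \<and> cocycle_of C \<in> B_dy \<AA>"
proof
  assume "C \<in> B_eq 1 \<AA>"
  then obtain C0 where C0: "equivariant_cochain 0 \<AA> C0" and C: "C = coboundary 0 \<AA> C0"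
    by (auto simp: C_eq_def)
  have val: "C \<zeta> a = C0 (boundary \<zeta>) a" if "\<zeta> \<in> chains 1" "a \<in> \<AA>" for \<zeta> a
    using that by (simp add: C coboundary_def)
  have Z: "C \<in> carrier (Z_eq 1 \<AA>)"
    unfolding Z_eq_carrier
  proof (intro conjI ballI)
    show "equivariant_cochain 1 \<AA> C"
      using equivariant_cochain_coboundary[OF sub C0] by (simp add: C)
    fix \<zeta> :: "'d cell \<Rightarrow>\<^sub>0 int" and a assume *: "\<zeta> \<in> chains (Suc 1)" "a \<in> \<AA>"
    have "C (boundary \<zeta>) a = C0 (boundary (boundary \<zeta>)) a"
      using * by (intro val boundary_chains)
    also have "\<dots> = 0"
      using * boundary_boundary_2[of \<zeta>] by (simp only: Suc_1 equivariant_cochain_0[OF C0])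
    finally show "C (boundary \<zeta>) a = 0" .
  qed
  have vx: "vertex z \<in> chains 0" for z :: "int ^ 'd::{finite,linorder}"
    by (simp add: vertex_def cells_def)
  have "cohomologous \<AA> (\<lambda>_ _. 0) (cocycle_of C)"
    unfolding cohomologous_def
  proof (intro exI conjI allI ballI)
    show "continuous_map (subtopology config_space \<AA>) euclidean (C0 (vertex 0))"
      using C0 vx unfolding equivariant_cochain_iff by blast
    fix z a assume a: "a \<in> \<AA>"
    have "C0 (vertex 0) (shift z a) = C0 (vertex z) a"
      using equivariant_cochain_shift[OF C0 vx a] by (simp add: translate_vertex)
    then show "cocycle_of C z a = C0 (vertex 0) (shift z a) + 0 - C0 (vertex 0) a"
      using val[OF lattice_path_chains a, of z]
      by (simp only: cocycle_of_def boundary_lattice_path equivariant_cochain_diff[OF C0 vx vx] add_0_right)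
  qed
  then have "cocycle_of C \<in> B_dy \<AA>"
    using dynamical_cocycle_cocycle_of[OF Z] by (simp add: B_dy_def Z_dy_carrier)
  with Z show "C \<in> carrier (Z_eq 1 \<AA>) \<and> cocycle_of C \<in> B_dy \<AA>" ..
next
  assume *: "C \<in> carrier (Z_eq 1 \<AA>) \<and> cocycle_of C \<in> B_dy \<AA>"
  then have eq: "equivariant_cochain 1 \<AA> C" by (simp add: Z_eq_carrier)
  from * obtain B where B: "continuous_map (subtopology config_space \<AA>) euclidean B"
    and CB: "\<And>z a. a \<in> \<AA> \<Longrightarrow> cocycle_of C z a = B (shift z a) - B a"
    by (auto simp: B_dy_def cohomologous_def)
  define C0 where "C0 = cochain_of 0 \<AA> (\<lambda>(x, _) a. B (shift x a))"
  have C0: "equivariant_cochain 0 \<AA> C0"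
    unfolding C0_def using continuous_map_compose_shift[OF sub B]
    by (intro equivariant_cochain_of[OF sub]) auto
  have "C = coboundary 0 \<AA> C0"
  proof (rule equivariant_cochain_eqI[OF eq])
    show "equivariant_cochain 1 \<AA> (coboundary 0 \<AA> C0)"
      using equivariant_cochain_coboundary[OF sub C0] by simp
    fix x a and S :: "'d set" assume S: "card S = 1" and a: "a \<in> \<AA>"
    then obtain i where i: "S = {i}" by (auto simp: card_1_singleton_iff)
    have "frag_of (x, S) \<in> chains (Suc 0)" using S by (simp add: cells_def)
    moreover from this have "boundary (frag_of (x, S)) \<in> chains 0" by (rule boundary_chains)
    ultimately have "coboundary 0 \<AA> C0 (frag_of (x, S)) a
        = frag_lift (\<lambda>(x, _). B (shift x a)) (boundary (frag_of (x, S)))"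
      using a by (simp add: coboundary_def C0_def cochain_of_def case_prod_unfold)
    also have "\<dots> = B (shift (x + axis i 1) a) - B (shift x a)"
      by (simp add: i boundary_edge_cell frag_lift_diff vertex_def)
    also have "\<dots> = C (frag_of (x, S)) a"
      using CB[OF shift_mem[OF sub a], of "axis i 1" x] cocycle_of_edge_cell[OF conjunct1[OF *] a, of x i]
      by (simp add: i add.commute)
    finally show "C (frag_of (x, S)) a = coboundary 0 \<AA> C0 (frag_of (x, S)) a" ..
  qed
  with C0 show "C \<in> B_eq 1 \<AA>" by (auto simp: C_eq_def)
qed

text \<open>Independence of the configuration removes the shift from the cocycle identity, leaving
  additivity; \<open>h\<close> is read off at any one configuration and is 0 if there is
  none.\<close>

lemma cocycle_of_const_hom:
  assumes C: "C \<in> carrier (Z_eq 1 \<AA>)" and sub: "subshift \<AA>"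
    and const: "\<And>\<zeta> a b. a \<in> \<AA> \<Longrightarrow> b \<in> \<AA> \<Longrightarrow> C \<zeta> a = C \<zeta> b"
  shows "\<exists>h. (\<forall>y z. h (y + z) = h y + h z) \<and> (\<forall>z. \<forall>a\<in>\<AA>. cocycle_of C z a = h z)"
proof (cases "\<AA> = {}")
  case True
  then show ?thesis by (intro exI[of _ "\<lambda>_. 0"]) simp
next
  case False
  then obtain b where b: "b \<in> \<AA>" by blast
  have "cocycle_of C (y + z) b = cocycle_of C y b + cocycle_of C z b" for y z
  proof -
    have "cocycle_of C (y + z) b = cocycle_of C y (shift z b) + cocycle_of C z b"
      using dynamical_cocycle_cocycle_of[OF C] b unfolding dynamical_cocycle_iff by blast
    also have "cocycle_of C y (shift z b) = cocycle_of C y b"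
      unfolding cocycle_of_def by (rule const[OF shift_mem[OF sub b] b])
    finally show ?thesis .
  qed
  moreover have "cocycle_of C z a = cocycle_of C z b" if "a \<in> \<AA>" for z a
    unfolding cocycle_of_def by (rule const[OF that b])
  ultimately show ?thesis by (intro exI[of _ "\<lambda>z. cocycle_of C z b"]) auto
qed

text \<open>A trivial cocycle is a homomorphism plus a cocycle cohomologous to 0. The first part
  comes from a configuration-independent \<open>E\<close>, the second from a coboundary. This
  supplies the condition on \<open>T\<close> in \<open>quotient_isos\<close>.\<close>

lemma B_dy_triv_iff:
  assumes sub: "subshift \<AA>" and C: "C \<in> carrier (Z_eq 1 \<AA>)"
  shows "cocycle_of C \<in> B_dy_triv \<AA> \<longleftrightarrow>
    (\<exists>E\<in>{E \<in> carrier (Z_eq 1 \<AA>). \<forall>\<zeta>. \<forall>a\<in>\<AA>. \<forall>b\<in>\<AA>. E \<zeta> a = E \<zeta> b}.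
       C \<in> B_eq 1 \<AA> #>\<^bsub>Z_eq 1 \<AA>\<^esub> E)"
proof
  assume "cocycle_of C \<in> B_dy_triv \<AA>"
  then obtain h where h: "\<And>y z. h (y + z) = h y + h z" "cohomologous \<AA> (\<lambda>z _. h z) (cocycle_of C)"
    unfolding B_dy_triv_def by blast
  \<comment> \<open>The homomorphism as a dynamical cocycle, with the default value 0 outside
    \<open>\<AA>\<close>.\<close>
  define D where "D = (\<lambda>z a. if a \<in> \<AA> then h z else 0)"
  have "continuous_map (subtopology config_space \<AA>) euclidean (D z)" for z
    by (rule continuous_map_eq[of _ _ "\<lambda>_. h z"]) (auto simp: D_def)
  then have D: "dynamical_cocycle \<AA> D"
    using shift_mem[OF sub] by (auto simp: dynamical_cocycle_iff D_def h(1))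
  define E where "E = cochain_of_cocycle \<AA> D"
  have E: "E \<in> carrier (Z_eq 1 \<AA>)" and DE: "cocycle_of E = D"
    unfolding E_def
    by (rule cochain_of_cocycle_Z_eq[OF sub D] cocycle_of_cochain_of_cocycle[OF sub D])+
  have const: "E \<zeta> a = E \<zeta> b" if "a \<in> \<AA>" "b \<in> \<AA>" for \<zeta> a b
  proof (cases "\<zeta> \<in> chains 1")
    case True
    \<comment> \<open>The potential behind \<open>E\<close> is \<open>h\<close> at every
      configuration of \<open>\<AA>\<close>.\<close>
    have "(\<lambda>(x, _). D x a) = (\<lambda>(x, _). D x b)" using that by (simp add: D_def)
    then show ?thesis unfolding E_def using cochain_of_cocycle_eq[OF D True] that by metis
  next
    case False
    then show ?thesis using E unfolding Z_eq_carrier equivariant_cochain_iff by metis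
  qed
  define F where "F = (\<lambda>\<zeta> a. C \<zeta> a - E \<zeta> a)"
  have "F \<in> carrier (Z_eq 1 \<AA>)"
    using diff_closed_Z_eq[of 1 \<AA>] C E unfolding diff_closed_def F_def by blast
  \<comment> \<open>Since \<open>cocycle_of E\<close> equals \<open>h\<close> on
    \<open>\<AA>\<close>, the transfer function of \<open>C\<close> also serves for
    \<open>F\<close>, now relative to 0.\<close>
  moreover have "cohomologous \<AA> (\<lambda>_ _. 0) (cocycle_of F)"
    using h(2) fun_cong[OF fun_cong[OF DE]]
    by (fastforce simp: cohomologous_def F_def cocycle_of_def D_def)
  ultimately have "F \<in> B_eq 1 \<AA>"
    unfolding B_eq_iff[OF sub] B_dy_def using dynamical_cocycle_cocycle_of
    by (auto simp: Z_dy_carrier)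
  moreover have "C = F \<otimes>\<^bsub>Z_eq 1 \<AA>\<^esub> E"
    by (simp add: F_def Z_eq_def C_eq_def)
  ultimately have "C \<in> B_eq 1 \<AA> #>\<^bsub>Z_eq 1 \<AA>\<^esub> E"
    unfolding r_coset_def by blast
  with E const show "\<exists>E\<in>{E \<in> carrier (Z_eq 1 \<AA>). \<forall>\<zeta>. \<forall>a\<in>\<AA>. \<forall>b\<in>\<AA>. E \<zeta> a = E \<zeta> b}.
       C \<in> B_eq 1 \<AA> #>\<^bsub>Z_eq 1 \<AA>\<^esub> E" by blast
next
  assume "\<exists>E\<in>{E \<in> carrier (Z_eq 1 \<AA>). \<forall>\<zeta>. \<forall>a\<in>\<AA>. \<forall>b\<in>\<AA>. E \<zeta> a = E \<zeta> b}.
       C \<in> B_eq 1 \<AA> #>\<^bsub>Z_eq 1 \<AA>\<^esub> E"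
  then obtain E F where E: "E \<in> carrier (Z_eq 1 \<AA>)"
    and const: "\<And>\<zeta> a b. a \<in> \<AA> \<Longrightarrow> b \<in> \<AA> \<Longrightarrow> E \<zeta> a = E \<zeta> b"
    and F: "F \<in> B_eq 1 \<AA>" and CF: "C = F \<otimes>\<^bsub>Z_eq 1 \<AA>\<^esub> E"
    unfolding r_coset_def by blast
  obtain h where h: "\<And>y z. h (y + z) = h y + h z" "\<And>z a. a \<in> \<AA> \<Longrightarrow> cocycle_of E z a = h z"
    using cocycle_of_const_hom[OF E sub const] by blast
  have "cohomologous \<AA> (\<lambda>_ _. 0) (cocycle_of F)"
    using F unfolding B_eq_iff[OF sub] by (simp add: B_dy_def)
  moreover have "cocycle_of C z a = cocycle_of F z a + cocycle_of E z a" for z a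
    by (simp add: CF cocycle_of_def Z_eq_def C_eq_def)
  ultimately have "cohomologous \<AA> (\<lambda>z _. h z) (cocycle_of C)"
    unfolding cohomologous_def by (auto simp: h(2) algebra_simps)
  then show "cocycle_of C \<in> B_dy_triv \<AA>"
    using h(1) dynamical_cocycle_cocycle_of[OF C] by (auto simp: B_dy_triv_def Z_dy_carrier)
qed

theorem theorem4p4:
  fixes \<AA> :: "('a::finite, 'd::{finite,linorder}) config set"
  assumes "subshift \<AA>"
  shows "\<exists>\<Phi> \<Psi> \<Theta>.
    \<Phi> \<in> iso (Z_eq 1 \<AA>) (Z_dy \<AA> :: ('a, 'd, 'g::topological_ab_group_add) lattice_fun monoid) \<and>
    (\<forall>C \<in> carrier (Z_eq 1 \<AA>). \<forall>z. \<forall>a \<in> \<AA>. \<forall>\<zeta> \<in> chains 1.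
       boundary \<zeta> = vertex z - vertex 0 \<longrightarrow> \<Phi> C z a = C \<zeta> a) \<and>
    (\<forall>C \<in> carrier (Z_eq 1 \<AA>). \<forall>x y. \<forall>a \<in> \<AA>.
       adjacent x y \<longrightarrow> C (edge x y) a = \<Phi> C (y - x) (shift x a)) \<and>
    \<Psi> \<in> iso (H_eq 1 \<AA>) (H_dy \<AA>) \<and>
    (\<forall>C \<in> carrier (Z_eq 1 \<AA>).
       \<Psi> (B_eq 1 \<AA> #>\<^bsub>Z_eq 1 \<AA>\<^esub> C) = B_dy \<AA> #>\<^bsub>Z_dy \<AA>\<^esub> \<Phi> C) \<and>
    \<Theta> \<in> iso (H_eq 1 \<AA> Mod const_classes 1 \<AA>) (H_dy_triv \<AA>) \<and>
    (\<forall>C \<in> carrier (Z_eq 1 \<AA>).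
       \<Theta> (const_classes 1 \<AA> #>\<^bsub>H_eq 1 \<AA>\<^esub> (B_eq 1 \<AA> #>\<^bsub>Z_eq 1 \<AA>\<^esub> C)) =
         B_dy_triv \<AA> #>\<^bsub>Z_dy \<AA>\<^esub> \<Phi> C)"
proof -
  let ?G = "Z_eq 1 \<AA> :: ('a, 'd, 'g) chain_fun monoid"
  let ?H = "Z_dy \<AA> :: ('a, 'd, 'g) lattice_fun monoid"
  let ?T = "{C \<in> carrier ?G. \<forall>\<zeta>. \<forall>a\<in>\<AA>. \<forall>b\<in>\<AA>. C \<zeta> a = C \<zeta> b}"
  have G: "comm_group ?G"
    using comm_group_pointwise_group[OF diff_closed_Z_eq, of 1 \<AA>, folded Z_eq_pointwise] .
  have H: "comm_group ?H"
    using comm_group_pointwise_group[OF diff_closed_Z_dy, of \<AA>, folded Z_dy_pointwise] .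
  have N: "subgroup (B_dy \<AA>) ?H" and N': "subgroup (B_dy_triv \<AA>) ?H"
    using subgroup_pointwise_group[OF diff_closed_Z_dy _ diff_closed_B_dy, of \<AA>]
      subgroup_pointwise_group[OF diff_closed_Z_dy _ diff_closed_B_dy_triv, of \<AA>]
    unfolding Z_dy_pointwise[symmetric] by (auto simp: B_dy_def B_dy_triv_def)
  have NN': "B_dy \<AA> \<subseteq> (B_dy_triv \<AA> :: ('a, 'd, 'g) lattice_fun set)"
    by (auto simp: B_dy_def B_dy_triv_def intro!: exI[of _ "\<lambda>_. 0"])
  have M: "B_eq 1 \<AA> = {C \<in> carrier ?G. cocycle_of C \<in> B_dy \<AA>}"
    using B_eq_iff[OF assms] by blast
  have T: "?T \<subseteq> carrier ?G" by blast
  note iso = cocycle_of_iso[OF assms]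
  \<comment> \<open>Here \<open>T\<close> is the set of configuration-independent closed cochains,
    whose classes make up \<open>const_classes 1 \<AA>\<close>.\<close>
  obtain \<Psi> \<Theta> where
    "\<Psi> \<in> iso (?G Mod B_eq 1 \<AA>) (?H Mod B_dy \<AA>)"
    "\<And>C. C \<in> carrier ?G \<Longrightarrow> \<Psi> (B_eq 1 \<AA> #>\<^bsub>?G\<^esub> C) = B_dy \<AA> #>\<^bsub>?H\<^esub> cocycle_of C"
    "\<Theta> \<in> iso (?G Mod B_eq 1 \<AA> Mod const_classes 1 \<AA>) (?H Mod B_dy_triv \<AA>)"
    "\<And>C. C \<in> carrier ?G \<Longrightarrow>
       \<Theta> (const_classes 1 \<AA> #>\<^bsub>?G Mod B_eq 1 \<AA>\<^esub> (B_eq 1 \<AA> #>\<^bsub>?G\<^esub> C))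
         = B_dy_triv \<AA> #>\<^bsub>?H\<^esub> cocycle_of C"
    unfolding const_classes_def
    by (rule quotient_isos[OF G H iso N N' NN' M T B_dy_triv_iff[OF assms]]) blast+
  moreover have "\<forall>C\<in>carrier (Z_eq 1 \<AA>). \<forall>z. \<forall>a\<in>\<AA>. \<forall>\<zeta>\<in>chains 1.
       boundary \<zeta> = vertex z - vertex 0 \<longrightarrow> (cocycle_of C :: ('a, 'd, 'g) lattice_fun) z a = C \<zeta> a"
    by (intro ballI allI impI cocycle_of_eq)
  moreover have "\<forall>C\<in>carrier (Z_eq 1 \<AA>). \<forall>x y. \<forall>a\<in>\<AA>. adjacent x y \<longrightarrow>
       C (edge x y) a = (cocycle_of C :: ('a, 'd, 'g) lattice_fun) (y - x) (shift x a)"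
    by (intro ballI allI impI cocycle_of_edge)
  ultimately show ?thesis
    unfolding H_eq_def H_dy_def H_dy_triv_def using iso by blast
qed

end
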